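(* Let $R\in M$ and $\mu_t\in M_t$, $t=0,\dots,T$, be probability measures, and consider the Schrödinger problem \[ \text{(SP)}\quad\text{minimize}\ \int_S\ln(d\lambda/dR)\,d\lambda\ \text{ over }\lambda\in M_+\ \text{ subject to }\ \lambda\ll R,\ \lambda_t=\mu_t,\ t=0,\dots,T . \] (1) Assume that $T=1$, $\prod_{t=0}^T\mu_t\ll R$ and that (SP) admits a feasible solution equivalent to $R$. Then the optimum in (SP) is attained and the optimal solutions $\lambda$ are characterized by the existence of an $x\in\prod_{t=0}^T\mathcal L^0_t$ such that \[ d\lambda/dR=\exp\Big(-\sum_{t=0}^Tx_t\Big)\quad R\text{-a.e.} \] (that is, a feasible $\lambda$ is optimal if and only if such an $x$ exists). (2) If $\prod_{t=0}^T\mu_t$ is feasible in (SP) and equivalent to $R$, then the same conclusion holds for any $T$ and, moreover, $x_t\in\mathcal L^1_t$ for every feasible $x$ in the problem \[ \text{minimize}\quad\int_S\Big[\sum_{t=0}^Tx_t+\frac{\exp(-\sum_{t=0}^Tx_t)-1}{\phi}\Big]d\mu\quad\text{over }x\in\prod_{t=0}^T\mathcal L^0_t, \] where $\mu=\prod_{t=0}^T\mu_t$ and $\phi=d\mu/dR$.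
   Context: $S_0,\dots,S_T$ are Polish spaces, $S=S_0\times\cdots\times S_T$, $\psi_t:S_t\to[1,\infty)$ are given continuous functions, $\psi(s)=\sum_{t=0}^T\psi_t(s_t)$. $M_t$ (resp. $M$) is the space of finite signed Borel measures on $S_t$ (resp. $S$) under which $\psi_t$ (resp. $\psi$) is integrable, and $M_+$ is the set of nonnegative elements of $M$. $\lambda_t$ is the $t$-th marginal of $\lambda$. $\mathcal L^0_t$ (resp. $\mathcal L^1_t$) is the space of real Borel measurable (resp. $\mu_t$-integrable) functions on $S_t$; $x_t$ is identified with $s\mapsto x_t(s_t)$ on $S$. Two measures are equivalent if they are mutually absolutely continuous. "Feasible" means satisfying the constraints with objective value less than $+\infty$. Integrals of functions are $+\infty$ unless the positive part is integrable. *)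

theory Defs
  imports "HOL-Probability.Probability"
begin

definition Polish_space :: "'a topology \<Rightarrow> bool" where
  "Polish_space X \<longleftrightarrow> completely_metrizable_space X \<and> separable_space X"

definition borel_of :: "'a topology \<Rightarrow> 'a measure" where
  "borel_of X = sigma (topspace X) {U. openin X U}"

text \<open>
  The spaces \<open>S 0, \<dots>, S T\<close> are topologies with possibly different carriers inside one type; any
  finite family of spaces arises this way (up to homeomorphism) via the disjoint sum of the carriers.
  Points of the product are the extensional functions on \<open>{..T}\<close>, as in \<^const>\<open>product_topology\<close>
  and \<^const>\<open>PiM\<close>.
\<close>

definition prod_space :: "nat \<Rightarrow> (nat \<Rightarrow> 'a topology) \<Rightarrow> (nat \<Rightarrow> 'a) topology" where
  "prod_space T S = product_topology S {..T}"

definition sep_sum :: "nat \<Rightarrow> (nat \<Rightarrow> 'a \<Rightarrow> real) \<Rightarrow> (nat \<Rightarrow> 'a) \<Rightarrow> real" where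
  "sep_sum T x s = (\<Sum>t\<le>T. x t (s t))"

text \<open>Nonnegative finite Borel measures on \<open>X\<close> that integrate the weight \<open>w\<close>.\<close>

definition weighted_measures :: "'a topology \<Rightarrow> ('a \<Rightarrow> real) \<Rightarrow> 'a measure set" where
  "weighted_measures X w = {\<nu>. sets \<nu> = sets (borel_of X) \<and> finite_measure \<nu> \<and> integrable \<nu> w}"

definition marginal :: "(nat \<Rightarrow> 'a topology) \<Rightarrow> (nat \<Rightarrow> 'a) measure \<Rightarrow> nat \<Rightarrow> 'a measure" where
  "marginal S \<nu> t = distr \<nu> (borel_of (S t)) (\<lambda>s. s t)"

text \<open>
  The integral with the convention that it is \<open>+\<infinity>\<close> unless the positive part is integrable;
  it may be \<open>-\<infinity>\<close>. Note that \<^const>\<open>ennreal\<close> maps negative reals to \<open>0\<close>.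
\<close>

definition ext_integral :: "'a measure \<Rightarrow> ('a \<Rightarrow> real) \<Rightarrow> ereal" where
  "ext_integral \<nu> f =
     (if (\<integral>\<^sup>+ s. ennreal (f s) \<partial>\<nu>) < \<infinity>
      then enn2ereal (\<integral>\<^sup>+ s. ennreal (f s) \<partial>\<nu>) - enn2ereal (\<integral>\<^sup>+ s. ennreal (- f s) \<partial>\<nu>)
      else \<infinity>)"

text \<open>\<^term>\<open>absolutely_continuous M N\<close> means \<open>N \<lless> M\<close>.\<close>

definition equivalent_measures :: "'a measure \<Rightarrow> 'a measure \<Rightarrow> bool" where
  "equivalent_measures M N \<longleftrightarrow> absolutely_continuous M N \<and> absolutely_continuous N M"

text \<open>
  \<^term>\<open>RN_deriv R \<nu>\<close> is the density of \<open>\<nu>\<close> with respect to \<open>R\<close>. It is positive and finite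
  \<open>\<nu>\<close>-almost everywhere when \<open>\<nu> \<lless> R\<close> are finite, so the values of \<^const>\<open>ln\<close> at \<open>0\<close> and of
  \<^const>\<open>enn2real\<close> at \<open>\<infinity>\<close> do not matter below.
\<close>

definition SP_objective :: "'b measure \<Rightarrow> 'b measure \<Rightarrow> ereal" where
  "SP_objective R \<nu> = ext_integral \<nu> (\<lambda>s. ln (enn2real (RN_deriv R \<nu> s)))"

definition SP_feasible ::
  "nat \<Rightarrow> (nat \<Rightarrow> 'a topology) \<Rightarrow> (nat \<Rightarrow> 'a \<Rightarrow> real) \<Rightarrow> (nat \<Rightarrow> 'a) measure \<Rightarrow>
   (nat \<Rightarrow> 'a measure) \<Rightarrow> (nat \<Rightarrow> 'a) measure \<Rightarrow> bool" where
  "SP_feasible T S \<psi> R \<mu> \<nu> \<longleftrightarrow>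
     \<nu> \<in> weighted_measures (prod_space T S) (sep_sum T \<psi>) \<and>
     absolutely_continuous R \<nu> \<and>
     (\<forall>t\<le>T. marginal S \<nu> t = \<mu> t) \<and>
     SP_objective R \<nu> < \<infinity>"

definition SP_optimal ::
  "nat \<Rightarrow> (nat \<Rightarrow> 'a topology) \<Rightarrow> (nat \<Rightarrow> 'a \<Rightarrow> real) \<Rightarrow> (nat \<Rightarrow> 'a) measure \<Rightarrow>
   (nat \<Rightarrow> 'a measure) \<Rightarrow> (nat \<Rightarrow> 'a) measure \<Rightarrow> bool" where
  "SP_optimal T S \<psi> R \<mu> \<nu> \<longleftrightarrow> is_arg_min (SP_objective R) (SP_feasible T S \<psi> R \<mu>) \<nu>"

text \<open>Families in \<open>\<Prod>t. L\<^sup>0\<^sub>t\<close>; the components beyond \<open>T\<close> are irrelevant.\<close>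

definition L0_family :: "nat \<Rightarrow> (nat \<Rightarrow> 'a topology) \<Rightarrow> (nat \<Rightarrow> 'a \<Rightarrow> real) set" where
  "L0_family T S = {x. \<forall>t\<le>T. x t \<in> borel_measurable (borel_of (S t))}"

definition dual_objective ::
  "nat \<Rightarrow> (nat \<Rightarrow> 'a) measure \<Rightarrow> (nat \<Rightarrow> 'a measure) \<Rightarrow> (nat \<Rightarrow> 'a \<Rightarrow> real) \<Rightarrow> ereal" where
  "dual_objective T R \<mu> x =
     ext_integral (PiM {..T} \<mu>)
       (\<lambda>s. sep_sum T x s
            + (exp (- sep_sum T x s) - 1) / enn2real (RN_deriv R (PiM {..T} \<mu>) s))"

definition dual_feasible ::
  "nat \<Rightarrow> (nat \<Rightarrow> 'a topology) \<Rightarrow> (nat \<Rightarrow> 'a) measure \<Rightarrow> (nat \<Rightarrow> 'a measure) \<Rightarrow>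
   (nat \<Rightarrow> 'a \<Rightarrow> real) \<Rightarrow> bool" where
  "dual_feasible T S R \<mu> x \<longleftrightarrow> x \<in> L0_family T S \<and> dual_objective T R \<mu> x < \<infinity>"

end

theory Submission
  imports Defs
begin

text \<open>
  Write \<open>p = d\<nu>/dR\<close> and \<open>H p = \<integral> p ln p dR\<close>, so that the problem is to minimize \<open>H\<close> over the
  densities with the prescribed marginals. Everything rests on the Fenchel inequality
  \<open>q ln q - q + exp b - b q \<ge> 0\<close> for \<open>q \<ge> 0\<close>, with equality only for \<open>q = exp b\<close>
  (\<open>entropy_fenchel\<close>).

  \<^emph>\<open>Existence, uniqueness and form of the optimum.\<close> Instead of minimizing \<open>H\<close> directly, take bounded
  separable functions \<open>g\<^sub>n\<close> that minimize the dual functional \<open>J g = \<integral> exp g dR - \<integral> g p dR\<close>, where \<open>p\<close> is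
  a feasible density that is positive almost everywhere; only the moments of \<open>p\<close>, that is, the marginals,
  enter. By Fenchel \<open>J\<close> is bounded below. The identity \<open>(exp a + exp b)/2 - exp ((a + b)/2) = (exp (a/2) - exp (b/2))\<^sup>2/2\<close>
  makes \<open>exp (g\<^sub>n/2)\<close> a Cauchy sequence in \<open>L\<^sup>2\<close>, hence \<open>exp g\<^sub>n\<close> converges in \<open>L\<^sup>1\<close> and almost everywhere to
  some \<open>f\<close>. Near-minimality in the directions \<open>\<plusminus>a\<close> shows in the limit that \<open>f\<close> has the prescribed
  marginals; Fatou's lemma applied to the Fenchel gap of \<open>p > 0\<close> shows \<open>f > 0\<close>; near-minimality in the
  direction \<open>- g\<^sub>n\<close> shows \<open>H f \<le> lim \<integral> g\<^sub>n p dR\<close>. Fatou's lemma applied to the Fenchel gap of an arbitrary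
  feasible density \<open>q\<close> then gives \<open>\<integral> (q ln q - q + f - q ln f) dR + H f \<le> H q\<close>
  (\<open>entropy_gap\<close>): \<open>f\<close> is the unique minimizer.

  Now \<open>ln f\<close> is an almost everywhere limit of separable functions. Such a limit is separable as soon as
  the product of the marginals is absolutely continuous with respect to \<open>R\<close>: after subtracting the values at
  a suitable reference point, obtained from Fubini's theorem, each coordinate function converges on its
  own (\<open>separable_limit\<close>).

  \<^emph>\<open>Sufficiency.\<close> If a feasible \<open>f\<close> equals \<open>exp g\<close> with \<open>g\<close> separable, then Fenchel with \<open>b = g\<close> gives
  \<open>H q \<ge> \<integral> g q dR\<close> for feasible \<open>q\<close>, and it remains to see that \<open>\<integral> g q dR = \<integral> g f dR = H f\<close>, although the
  summands of \<open>g\<close> need not be integrable. For two marginals, clipping both summands at the same height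
  dominates the sum by \<open>|g|\<close>, with the right signs (\<open>integral_add_eq_of_clip\<close>). If the product
  measure is feasible, then the positive part of \<open>g\<close> is integrable under it, and Fubini's theorem yields
  the same for each summand, from which the integrability of the summands follows
  (\<open>integrable_components_of_product\<close>).

  \<^emph>\<open>The last claim.\<close> With \<open>X\<close> the sum of the \<open>x\<^sub>t\<close> and \<open>u = - X - ln \<phi>\<close>, the inequality \<open>|u| \<le> exp u - u\<close>
  bounds \<open>|u|\<close> by the dual integrand plus \<open>1/\<phi> + ln \<phi>\<close>, so that \<open>X\<close> is integrable under the product
  measure, and Fubini's theorem again separates the summands.
\<close>

section \<open>Entropy inequalities and convergence of integrals\<close>

lemma entropy_fenchel:
  fixes q b :: real
  assumes "0 \<le> q"
  shows "0 \<le> q * ln q - q + exp b - b * q"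
    and "q * ln q - q + exp b - b * q = 0 \<Longrightarrow> q = exp b"
proof -
  have *: "q * ln q - q + exp b - b * q = q * (exp b / q - 1 - ln (exp b / q))" if "q > 0"
    using that by (simp add: ln_div right_diff_distrib)
  show "0 \<le> q * ln q - q + exp b - b * q"
  proof (cases "q > 0")
    case True
    have "ln (exp b / q) \<le> exp b / q - 1"
      using True by (intro ln_le_minus_one) auto
    then show ?thesis
      unfolding *[OF True] using True by (intro mult_nonneg_nonneg) auto
  qed (use assms in auto)
  show "q = exp b" if eq: "q * ln q - q + exp b - b * q = 0"
  proof (cases "q > 0")
    case True
    then have "ln (exp b / q) = exp b / q - 1"
      using eq unfolding *[OF True] by simp
    then have "exp b / q = 1"
      using True by (intro ln_eq_minus_one) auto
    then show ?thesis using True by simp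
  next
    case False
    then show ?thesis using assms eq by auto
  qed
qed

lemma mult_exp_ge: "- 1 \<le> u * exp (u :: real)"
proof -
  have "- u \<le> exp (- u)"
    using exp_ge_add_one_self[of "- u"] by linarith
  then have "- u * exp u \<le> exp (- u) * exp u"
    by (intro mult_right_mono) auto
  then show ?thesis by (simp flip: exp_add)
qed

lemma entropy_ge: "0 \<le> q \<Longrightarrow> - 1 \<le> q * ln (q :: real)"
  using mult_exp_ge[of "ln q"] by (cases "q = 0") (auto simp: mult.commute)

text \<open>
  Compares the \<open>L\<^sup>1\<close> and the Hellinger distance of \<open>exp u\<close> and \<open>exp v\<close>; the weight \<open>c\<close> replaces the
  Cauchy-Schwarz inequality.
\<close>

lemma exp_diff_le:
  fixes c u v :: real
  assumes "0 < c"
  shows "\<bar>exp u - exp v\<bar> \<le> c / 2 * (exp (u / 2) - exp (v / 2))\<^sup>2 + 1 / c * (exp u + exp v)"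
proof -
  define a b where "a = exp (u / 2)" and "b = exp (v / 2)"
  have ab: "exp u = a\<^sup>2" "exp v = b\<^sup>2"
    by (simp_all add: a_def b_def power2_eq_square flip: exp_add)
  define x y where "x = \<bar>a - b\<bar>" and "y = a + b"
  have "0 < y" by (simp add: y_def a_def b_def add_pos_pos)
  then have "\<bar>a\<^sup>2 - b\<^sup>2\<bar> = x * y"
    by (simp add: x_def y_def power2_eq_square square_diff_square_factored abs_mult)
  moreover have "c / 2 * x\<^sup>2 + 1 / (2 * c) * y\<^sup>2 - x * y = (c * x - y)\<^sup>2 / (2 * c)"
    using assms by (simp add: field_simps power2_eq_square)
  then have "0 \<le> c / 2 * x\<^sup>2 + 1 / (2 * c) * y\<^sup>2 - x * y"
    using assms by simp
  moreover have "1 / (2 * c) * y\<^sup>2 \<le> 1 / (2 * c) * (2 * (a\<^sup>2 + b\<^sup>2))"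
  proof (rule mult_left_mono)
    have "0 \<le> (a - b)\<^sup>2" by simp
    then show "y\<^sup>2 \<le> 2 * (a\<^sup>2 + b\<^sup>2)"
      unfolding y_def power2_sum power2_diff distrib_left by linarith
  qed (use assms in simp)
  moreover have "c / 2 * x\<^sup>2 = c / 2 * (a - b)\<^sup>2" by (simp add: x_def)
  moreover have "1 / (2 * c) * (2 * (a\<^sup>2 + b\<^sup>2)) = 1 / c * (a\<^sup>2 + b\<^sup>2)"
    using assms by (simp add: field_simps)
  ultimately have "\<bar>a\<^sup>2 - b\<^sup>2\<bar> \<le> c / 2 * (a - b)\<^sup>2 + 1 / c * (a\<^sup>2 + b\<^sup>2)"
    by linarith
  then show ?thesis unfolding ab by (simp only: a_def b_def)
qed

text \<open>Fatou's lemma for nonnegative real functions with convergent bounds on the integrals.\<close>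

lemma fatou_real:
  fixes u :: "nat \<Rightarrow> 'b \<Rightarrow> real"
  assumes int: "\<And>n. integrable M (u n)" and nn: "\<And>n s. 0 \<le> u n s"
    and v[measurable]: "v \<in> borel_measurable M" and lim: "AE s in M. (\<lambda>n. u n s) \<longlonglongrightarrow> v s"
    and le: "\<And>n. (\<integral>s. u n s \<partial>M) \<le> c n" and c: "c \<longlonglongrightarrow> C"
  shows "integrable M v" and "(\<integral>s. v s \<partial>M) \<le> C"
proof -
  have [measurable]: "u n \<in> borel_measurable M" for n using int by auto
  have v_nn: "AE s in M. 0 \<le> v s"
    using lim by eventually_elim (auto intro: LIMSEQ_le_const nn)
  have c_nn: "0 \<le> c n" for n
    using order_trans[OF Bochner_Integration.integral_nonneg le[of n]] nn by simp
  then have C_nn: "0 \<le> C" using c by (auto intro: LIMSEQ_le_const)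
  have "(\<integral>\<^sup>+s. ennreal (v s) \<partial>M) = (\<integral>\<^sup>+s. liminf (\<lambda>n. ennreal (u n s)) \<partial>M)"
  proof (rule nn_integral_cong_AE)
    show "AE s in M. ennreal (v s) = liminf (\<lambda>n. ennreal (u n s))"
      using lim
    proof eventually_elim
      case (elim s)
      then have "(\<lambda>n. ennreal (u n s)) \<longlonglongrightarrow> ennreal (v s)" by (rule tendsto_ennrealI)
      then show ?case by (rule lim_imp_Liminf[OF sequentially_bot, symmetric])
    qed
  qed
  also have "\<dots> \<le> liminf (\<lambda>n. \<integral>\<^sup>+s. ennreal (u n s) \<partial>M)"
    by (rule nn_integral_liminf) measurable
  also have "\<dots> \<le> liminf (\<lambda>n. ennreal (c n))"
  proof (rule Liminf_mono, rule always_eventually, rule allI)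
    fix n
    have "(\<integral>\<^sup>+s. ennreal (u n s) \<partial>M) = ennreal (\<integral>s. u n s \<partial>M)"
      using int nn by (intro nn_integral_eq_integral) auto
    then show "(\<integral>\<^sup>+s. ennreal (u n s) \<partial>M) \<le> ennreal (c n)"
      using le by (simp add: ennreal_leI)
  qed
  also have "\<dots> = ennreal C"
    using tendsto_ennrealI[OF c] by (rule lim_imp_Liminf[OF sequentially_bot])
  finally have le_C: "(\<integral>\<^sup>+s. ennreal (v s) \<partial>M) \<le> ennreal C" .
  then have fin: "(\<integral>\<^sup>+s. ennreal (v s) \<partial>M) < \<infinity>"
    using ennreal_less_top le_less_trans by fastforce
  show "integrable M v"
    by (rule integrableI_nonneg) (use v_nn fin in auto)
  then have "ennreal (\<integral>s. v s \<partial>M) \<le> ennreal C"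
    using le_C v_nn by (simp add: nn_integral_eq_integral)
  then show "(\<integral>s. v s \<partial>M) \<le> C"
    using C_nn by simp
qed

lemma exp_le_quadratic:
  fixes u :: real
  assumes "u \<le> 1/2"
  shows "exp u \<le> 1 + u + 2 * u\<^sup>2"
proof -
  have "1 - u \<le> exp (- u)" using exp_ge_add_one_self[of "- u"] by simp
  then have "exp u * (1 - u) \<le> exp u * exp (- u)" by (intro mult_left_mono) auto
  then have "exp u * (1 - u) \<le> 1" by (simp flip: exp_add)
  also have "1 \<le> (1 + u + 2 * u\<^sup>2) * (1 - u)"
  proof -
    have "(1 + u + 2 * u\<^sup>2) * (1 - u) - 1 = u\<^sup>2 * (1 - 2 * u)"
      by (simp add: power2_eq_square algebra_simps)
    also have "0 \<le> \<dots>" using assms by (intro mult_nonneg_nonneg) auto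
    finally show ?thesis by simp
  qed
  finally show ?thesis using assms by (simp add: mult_le_cancel_right)
qed

text \<open>
  A sequence whose increments are geometrically small in \<open>L\<^sup>1\<close> converges almost everywhere and is dominated
  by the integrable function \<open>|k\<^sub>0| + \<Sum>\<^sub>n |k\<^sub>n\<^sub>+\<^sub>1 - k\<^sub>n|\<close>.
\<close>

lemma fast_L1_limit:
  fixes k :: "nat \<Rightarrow> 'b \<Rightarrow> real"
  assumes int[measurable]: "\<And>n. integrable M (k n)"
    and fast: "\<And>n. (\<integral>s. \<bar>k (Suc n) s - k n s\<bar> \<partial>M) \<le> C * (1/2) ^ n"
  obtains f W where "f \<in> borel_measurable M" "integrable M W"
    "AE s in M. (\<lambda>n. k n s) \<longlonglongrightarrow> f s" "AE s in M. \<forall>n. \<bar>k n s\<bar> \<le> W s"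
proof -
  define D where "D n s = \<bar>k (Suc n) s - k n s\<bar>" for n s
  have kM[measurable]: "k n \<in> borel_measurable M" for n using int by auto
  have DM[measurable]: "D n \<in> borel_measurable M" for n unfolding D_def by measurable
  have Dint: "integrable M (D n)" for n unfolding D_def using int by auto
  have Dnn: "0 \<le> D n s" for n s by (simp add: D_def)
  have sum: "summable (\<lambda>n. \<integral>s. D n s \<partial>M)"
    by (rule summable_comparison_test'[where g = "\<lambda>n. C * (1/2) ^ n" and N = 0])
      (use fast Dnn in \<open>auto simp: D_def intro!: summable_mult summable_geometric\<close>)
  have "(\<integral>\<^sup>+s. (\<Sum>n. ennreal (D n s)) \<partial>M) = (\<Sum>n. \<integral>\<^sup>+s. ennreal (D n s) \<partial>M)"
    by (intro nn_integral_suminf) auto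
  also have "\<dots> = (\<Sum>n. ennreal (\<integral>s. D n s \<partial>M))"
    using Dint Dnn by (simp add: nn_integral_eq_integral)
  also have "\<dots> = ennreal (\<Sum>n. \<integral>s. D n s \<partial>M)"
    by (intro suminf_ennreal2 sum) (simp add: Dnn)
  finally have "(\<integral>\<^sup>+s. (\<Sum>n. ennreal (D n s)) \<partial>M) \<noteq> \<infinity>" by simp
  then have "AE s in M. (\<Sum>n. ennreal (D n s)) \<noteq> \<infinity>"
    by (intro nn_integral_PInf_AE) auto
  then have AE_sum: "AE s in M. summable (\<lambda>n. D n s)"
    by (rule AE_mp) (auto intro!: AE_I2 summable_suminf_not_top Dnn)
  define W where "W s = \<bar>k 0 s\<bar> + (\<Sum>n. D n s)" for s
  have W: "integrable M W"
    unfolding W_def using int AE_sum sum Dnn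
    by (intro Bochner_Integration.integrable_add integrable_suminf Dint) auto
  have tele: "k n s = k 0 s + (\<Sum>i<n. k (Suc i) s - k i s)" for n s
    using sum_lessThan_telescope[of "\<lambda>i. k i s" n] by simp
  show thesis
  proof (rule that[of "\<lambda>s. lim (\<lambda>n. k n s)" W])
    show "(\<lambda>s. lim (\<lambda>n. k n s)) \<in> borel_measurable M" by measurable
    show "AE s in M. (\<lambda>n. k n s) \<longlonglongrightarrow> lim (\<lambda>n. k n s)"
      using AE_sum
    proof eventually_elim
      case (elim s)
      then have "summable (\<lambda>n. k (Suc n) s - k n s)"
        unfolding D_def by (rule summable_rabs_cancel)
      then have "(\<lambda>n. \<Sum>i<n. k (Suc i) s - k i s) \<longlonglongrightarrow> (\<Sum>n. k (Suc n) s - k n s)"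
        by (rule summable_LIMSEQ)
      then have "convergent (\<lambda>n. k 0 s + (\<Sum>i<n. k (Suc i) s - k i s))"
        by (intro convergentI[of _ "k 0 s + (\<Sum>n. k (Suc n) s - k n s)"] tendsto_intros)
      then have "convergent (\<lambda>n. k n s)"
        by (subst tele)
      then show ?case by (simp add: convergent_LIMSEQ_iff)
    qed
    show "AE s in M. \<forall>n. \<bar>k n s\<bar> \<le> W s"
      using AE_sum
    proof eventually_elim
      case (elim s)
      have "\<bar>k n s\<bar> \<le> W s" for n
      proof -
        have "\<bar>k n s\<bar> \<le> \<bar>k 0 s\<bar> + \<bar>\<Sum>i<n. k (Suc i) s - k i s\<bar>"
          by (subst tele) (rule abs_triangle_ineq)
        also have "\<bar>\<Sum>i<n. k (Suc i) s - k i s\<bar> \<le> (\<Sum>i<n. D i s)"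
          unfolding D_def by (rule sum_abs)
        also have "\<dots> \<le> (\<Sum>i. D i s)"
          using elim Dnn by (intro sum_le_suminf) auto
        finally show ?thesis by (simp add: W_def)
      qed
      then show ?case by blast
    qed
  qed (fact W)
qed

section \<open>Entropy minimization under moment constraints\<close>

text \<open>
  \<open>V\<close> is a linear space of bounded test functions containing the constants, and \<open>p\<close> is a positive
  probability density of finite entropy. The densities of interest are those with the same \<open>V\<close>-moments
  as \<open>p\<close>.
\<close>

locale moment_constraints = prob_space R
  for R :: "'b measure" and V :: "('b \<Rightarrow> real) set" and p :: "'b \<Rightarrow> real" +
  assumes V_one: "(\<lambda>s. 1) \<in> V"
    and V_add: "\<And>g h c. g \<in> V \<Longrightarrow> h \<in> V \<Longrightarrow> (\<lambda>s. g s + c * h s) \<in> V"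
    and V_meas: "\<And>g. g \<in> V \<Longrightarrow> g \<in> borel_measurable R"
    and V_bdd: "\<And>g. g \<in> V \<Longrightarrow> \<exists>B. \<forall>s. \<bar>g s\<bar> \<le> B"
    and p_int[measurable]: "integrable R p"
    and p_nonneg: "\<And>s. 0 \<le> p s"
    and p_pos: "AE s in R. 0 < p s"
    and p_one: "(\<integral>s. p s \<partial>R) = 1"
    and p_ent: "integrable R (\<lambda>s. p s * ln (p s))"
begin

text \<open>The dual functional; it depends on \<open>p\<close> only through its \<open>V\<close>-moments.\<close>

definition J :: "('b \<Rightarrow> real) \<Rightarrow> real" where
  "J g = (\<integral>s. exp (g s) \<partial>R) - (\<integral>s. g s * p s \<partial>R)"

lemma V_mult: "g \<in> V \<Longrightarrow> (\<lambda>s. c * g s) \<in> V"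
  using V_add[of g g "c - 1"] by (simp add: algebra_simps)

lemma exp_V_int[simp]: assumes "g \<in> V" shows "integrable R (\<lambda>s. exp (c * g s))"
proof -
  obtain B where B: "\<And>s. \<bar>g s\<bar> \<le> B" using V_bdd[OF assms] by auto
  have "c * g s \<le> \<bar>c\<bar> * B" for s
    using abs_ge_self[of "c * g s"] mult_left_mono[OF B[of s], of "\<bar>c\<bar>"] by (simp add: abs_mult)
  then show ?thesis
    using V_meas[OF assms] by (intro integrable_const_bound[where B = "exp (\<bar>c\<bar> * B)"]) auto
qed

lemma exp_V_int1[simp]: "g \<in> V \<Longrightarrow> integrable R (\<lambda>s. exp (g s))"
  using exp_V_int[of g 1] by simp

lemma V_mult_int[simp]: assumes "g \<in> V" and "integrable R q" shows "integrable R (\<lambda>s. g s * q s)"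
proof -
  obtain B where B: "\<And>s. \<bar>g s\<bar> \<le> B" using V_bdd[OF assms(1)] by auto
  have bound: "\<bar>g s * q s\<bar> \<le> \<bar>B * q s\<bar>" for s
    using B[of s] by (simp add: abs_mult mult_right_mono)
  have int: "integrable R (\<lambda>s. B * q s)" using assms by simp
  have meas: "(\<lambda>s. g s * q s) \<in> borel_measurable R"
    using V_meas[OF assms(1)] assms(2) by simp
  show ?thesis
    by (rule Bochner_Integration.integrable_bound[OF int meas]) (simp add: bound)
qed

lemma J_ge: assumes "g \<in> V" shows "1 - (\<integral>s. p s * ln (p s) \<partial>R) \<le> J g"
proof -
  have "0 \<le> (\<integral>s. p s * ln (p s) - p s + exp (g s) - g s * p s \<partial>R)"
    by (intro integral_nonneg_AE AE_I2 entropy_fenchel p_nonneg)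
  also have "\<dots> = (\<integral>s. p s * ln (p s) \<partial>R) - 1 + J g"
    using assms p_int p_ent p_one by (simp add: J_def)
  finally show ?thesis by simp
qed

lemma J_bdd: "bdd_below (J ` V)"
  using J_ge by (intro bdd_belowI2)

text \<open>The dual value.\<close>

definition m where "m = (INF g\<in>V. J g)"

lemma m_le: "g \<in> V \<Longrightarrow> m \<le> J g"
  unfolding m_def by (intro cINF_lower J_bdd)

text \<open>Strong convexity of \<open>J\<close>: near-minimizers are close in the Hellinger distance.\<close>

lemma J_midpoint:
  assumes g: "g \<in> V" and h: "h \<in> V"
  shows "integrable R (\<lambda>s. (exp (g s / 2) - exp (h s / 2))\<^sup>2)"
    and "(\<integral>s. (exp (g s / 2) - exp (h s / 2))\<^sup>2 \<partial>R) \<le> (J g - m) + (J h - m)"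
proof -
  let ?k = "\<lambda>s. (g s + h s) / 2"
  have k: "?k \<in> V"
    using V_mult[OF V_add[OF g h, of 1], of "1/2"] by simp
  have eq: "(exp (g s / 2) - exp (h s / 2))\<^sup>2 = exp (g s) + exp (h s) - 2 * exp (?k s)" for s
    by (simp add: power2_eq_square algebra_simps add_divide_distrib flip: exp_add)
  show "integrable R (\<lambda>s. (exp (g s / 2) - exp (h s / 2))\<^sup>2)"
    unfolding eq using g h k by simp
  have "(\<integral>s. (exp (g s / 2) - exp (h s / 2))\<^sup>2 \<partial>R)
      = (\<integral>s. exp (g s) \<partial>R) + (\<integral>s. exp (h s) \<partial>R) - 2 * (\<integral>s. exp (?k s) \<partial>R)"
    unfolding eq using g h k by simp
  also have "\<dots> = J g + J h - 2 * J ?k"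
  proof -
    have "(\<integral>s. ?k s * p s \<partial>R) = (\<integral>s. (g s * p s + h s * p s) / 2 \<partial>R)"
      by (intro Bochner_Integration.integral_cong) (auto simp: field_simps)
    also have "\<dots> = ((\<integral>s. g s * p s \<partial>R) + (\<integral>s. h s * p s \<partial>R)) / 2"
      using g h p_int by simp
    finally show ?thesis by (simp add: J_def field_simps)
  qed
  also have "\<dots> \<le> (J g - m) + (J h - m)" using m_le[OF k] by simp
  finally show "(\<integral>s. (exp (g s / 2) - exp (h s / 2))\<^sup>2 \<partial>R) \<le> (J g - m) + (J h - m)" .
qed

text \<open>The approximate stationarity of a near-minimizer \<open>g\<close> in the direction \<open>h\<close>.\<close>

lemma J_near_min:
  assumes g: "g \<in> V" and h: "h \<in> V"
  shows "(\<integral>s. exp (g s) - exp (g s + c * h s) \<partial>R) \<le> J g - m - c * (\<integral>s. h s * p s \<partial>R)"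
proof -
  have gh: "(\<lambda>s. g s + c * h s) \<in> V" by (rule V_add[OF g h])
  have "(\<integral>s. (g s + c * h s) * p s \<partial>R) = (\<integral>s. g s * p s + c * (h s * p s) \<partial>R)"
    by (intro Bochner_Integration.integral_cong) (auto simp: algebra_simps)
  also have "\<dots> = (\<integral>s. g s * p s \<partial>R) + c * (\<integral>s. h s * p s \<partial>R)"
    using g h p_int by simp
  finally show ?thesis
    using m_le[OF gh] g gh by (simp add: J_def)
qed

text \<open>Near-minimizers have bounded mass: compare \<open>g\<close> with \<open>g - 1\<close>.\<close>

lemma exp_mass_le:
  assumes g: "g \<in> V" and "J g \<le> m + 1"
  shows "(\<integral>s. exp (g s) \<partial>R) \<le> 4"
proof -
  have "(\<integral>s. exp (g s) - exp (g s + (-1) * 1) \<partial>R) = (\<integral>s. (1 - exp (-1)) * exp (g s) \<partial>R)"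
    by (intro Bochner_Integration.integral_cong) (auto simp: algebra_simps simp flip: exp_add)
  also have "\<dots> = (1 - exp (-1)) * (\<integral>s. exp (g s) \<partial>R)" using g by simp
  finally have "(1 - exp (-1)) * (\<integral>s. exp (g s) \<partial>R) \<le> 2"
    using J_near_min[OF g V_one, of "-1"] assms(2) by (simp add: p_one)
  moreover have "1/2 \<le> 1 - exp (-1 :: real)"
    using exp_ge_add_one_self[of "1::real"] by (simp add: exp_minus field_simps)
  then have "1/2 * (\<integral>s. exp (g s) \<partial>R) \<le> (1 - exp (-1)) * (\<integral>s. exp (g s) \<partial>R)"
    by (intro mult_right_mono) auto
  ultimately show ?thesis by linarith
qed

lemma L1_dist_le:
  assumes g: "g \<in> V" "J g \<le> m + d" and h: "h \<in> V" "J h \<le> m + d" and d: "d \<le> 1" and c: "0 < c"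
  shows "(\<integral>s. \<bar>exp (h s) - exp (g s)\<bar> \<partial>R) \<le> c * d + 8 / c"
proof -
  let ?d = "\<lambda>s. (exp (h s / 2) - exp (g s / 2))\<^sup>2"
  have int: "integrable R ?d" by (rule J_midpoint(1)[OF h(1) g(1)])
  have "(\<integral>s. \<bar>exp (h s) - exp (g s)\<bar> \<partial>R)
      \<le> (\<integral>s. c / 2 * ?d s + 1 / c * (exp (h s) + exp (g s)) \<partial>R)"
    by (intro integral_mono exp_diff_le c Bochner_Integration.integrable_add integrable_mult_right
      Bochner_Integration.integrable_diff integrable_abs int exp_V_int1 g(1) h(1))
  also have "\<dots> = c / 2 * (\<integral>s. ?d s \<partial>R) + 1 / c * ((\<integral>s. exp (h s) \<partial>R) + (\<integral>s. exp (g s) \<partial>R))"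
    using g(1) h(1) int by simp
  also have "\<dots> \<le> c / 2 * (d + d) + 1 / c * (4 + 4)"
  proof (rule add_mono; rule mult_left_mono)
    show "(\<integral>s. ?d s \<partial>R) \<le> d + d"
      using J_midpoint(2)[OF h(1) g(1)] g(2) h(2) by linarith
    show "(\<integral>s. exp (h s) \<partial>R) + (\<integral>s. exp (g s) \<partial>R) \<le> 4 + 4"
      using exp_mass_le[OF g(1)] exp_mass_le[OF h(1)] g(2) h(2) d by linarith
  qed (use c in simp_all)
  finally show ?thesis by simp
qed

end

text \<open>
  A minimizing sequence of \<open>J\<close> along which \<open>exp g\<^sub>n\<close> converges to \<open>f\<close>, dominated by \<open>W\<close>.
\<close>

locale minimizing_sequence = moment_constraints R V p
  for R :: "'b measure" and V :: "('b \<Rightarrow> real) set" and p :: "'b \<Rightarrow> real" +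
  fixes g :: "nat \<Rightarrow> 'b \<Rightarrow> real" and f W :: "'b \<Rightarrow> real"
  assumes g_V: "\<And>n. g n \<in> V"
    and near: "\<And>n. J (g n) \<le> m + (1/4) ^ n"
    and f_meas[measurable]: "f \<in> borel_measurable R"
    and W_int: "integrable R W"
    and lim: "AE s in R. (\<lambda>n. exp (g n s)) \<longlonglongrightarrow> f s"
    and dom: "AE s in R. \<forall>n. exp (g n s) \<le> W s"

lemma (in moment_constraints) ex_minimizing_sequence:
  obtains g f W where "minimizing_sequence R V p g f W"
proof -
  have "\<exists>g\<in>V. J g < m + (1/4) ^ n" for n
    using V_one J_bdd unfolding m_def
    by (subst cINF_less_iff[symmetric]) (auto simp: m_def[symmetric])
  then obtain g where g: "\<And>n. g n \<in> V" "\<And>n. J (g n) < m + (1/4) ^ n" by metis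
  have dist: "(\<integral>s. \<bar>exp (g (Suc n) s) - exp (g n s)\<bar> \<partial>R) \<le> 9 * (1/2) ^ n" for n
  proof -
    have "J (g (Suc n)) \<le> m + (1/4) ^ n"
      using g(2)[of "Suc n"] by (auto intro: order_trans[OF less_imp_le])
    moreover have "(1/4 :: real) ^ n \<le> 1" by (simp add: power_le_one)
    ultimately have "(\<integral>s. \<bar>exp (g (Suc n) s) - exp (g n s)\<bar> \<partial>R) \<le> 2 ^ n * (1/4) ^ n + 8 / 2 ^ n"
      \<comment> \<open>the weight \<open>2 ^ n\<close> balances the two terms of the bound\<close>
      using g less_imp_le[OF g(2)[of n]] by (intro L1_dist_le) auto
    also have "(2::real) ^ n * (1/4) ^ n = (1/2) ^ n"
      using power_mult_distrib[of "2::real" "1/4" n] by simp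
    finally show ?thesis by (simp add: power_one_over)
  qed
  obtain f W where "f \<in> borel_measurable R" "integrable R W"
      "AE s in R. (\<lambda>n. exp (g n s)) \<longlonglongrightarrow> f s" "AE s in R. \<forall>n. \<bar>exp (g n s)\<bar> \<le> W s"
    using fast_L1_limit[of R "\<lambda>n s. exp (g n s)" 9] g(1) dist exp_V_int1 by blast
  then have "minimizing_sequence R V p g f W"
    using g by unfold_locales (auto intro: less_imp_le)
  then show thesis by (rule that)
qed

context minimizing_sequence
begin

lemma g_meas[measurable]: "g n \<in> borel_measurable R"
  using V_meas[OF g_V] .

lemma p_meas[measurable]: "p \<in> borel_measurable R"
  using p_int by auto

lemma f_nonneg: "AE s in R. 0 \<le> f s"
  using lim by eventually_elim (auto intro: LIMSEQ_le_const)

lemma limit_bounded: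
  assumes b[measurable]: "b \<in> borel_measurable R" and bdd: "\<And>s. \<bar>b s\<bar> \<le> B"
  shows "integrable R (\<lambda>s. b s * f s)"
    and "(\<lambda>n. \<integral>s. b s * exp (g n s) \<partial>R) \<longlonglongrightarrow> (\<integral>s. b s * f s \<partial>R)"
proof -
  have "0 \<le> B" using bdd[of undefined] by linarith
  have l: "AE s in R. (\<lambda>n. b s * exp (g n s)) \<longlonglongrightarrow> b s * f s"
    using lim by eventually_elim (rule tendsto_mult_left)
  have d: "AE s in R. norm (b s * exp (g n s)) \<le> B * W s" for n
    using dom by eventually_elim (auto simp: abs_mult intro!: mult_mono bdd \<open>0 \<le> B\<close>)
  have w: "integrable R (\<lambda>s. B * W s)" using W_int by simp
  show "integrable R (\<lambda>s. b s * f s)"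
    by (rule integrable_dominated_convergence[OF _ _ w l d]) measurable
  show "(\<lambda>n. \<integral>s. b s * exp (g n s) \<partial>R) \<longlonglongrightarrow> (\<integral>s. b s * f s \<partial>R)"
    by (rule integral_dominated_convergence[OF _ _ w l d]) measurable
qed

lemma f_int: "integrable R f"
  using limit_bounded(1)[of "\<lambda>s. 1" 1] by simp

text \<open>
  Moving from \<open>g\<^sub>n\<close> to \<open>g\<^sub>n + c a\<close> with small \<open>c > 0\<close> lowers \<open>J\<close> by at most \<open>(1/4)\<^sup>n\<close>; let \<open>n \<rightarrow> \<infinity>\<close> and then
  \<open>c \<rightarrow> 0\<close>.
\<close>

lemma moment_le:
  assumes a: "a \<in> V"
  shows "(\<integral>s. a s * p s \<partial>R) \<le> (\<integral>s. a s * f s \<partial>R)"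
proof -
  have [measurable]: "a \<in> borel_measurable R" by (rule V_meas[OF a])
  obtain B' where B': "\<And>s. \<bar>a s\<bar> \<le> B'" using V_bdd[OF a] by auto
  define B where "B = max 1 B'"
  have B: "\<bar>a s\<bar> \<le> B" "1 \<le> B" for s using B'[of s] by (auto simp: B_def)
  define F where "F = (\<integral>s. f s \<partial>R)"
  have step: "(\<integral>s. a s * p s \<partial>R) \<le> (\<integral>s. a s * f s \<partial>R) + 2 * c * B\<^sup>2 * F"
    if c: "0 < c" "c * B \<le> 1/2" for c
  proof -
    have ca: "\<bar>c * a s\<bar> \<le> c * B" for s
      using c(1) B(1)[of s] by (simp add: abs_mult)
    have ca': "c * a s \<le> 1/2" for s using ca[of s] c(2) by linarith
    have e: "\<bar>1 - exp (c * a s)\<bar> \<le> 1 + exp (1/2)" for s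
      using ca'[of s] exp_gt_zero[of "c * a s"] exp_le_cancel_iff[of "c * a s" "1/2"] by linarith
    have "(\<lambda>n. \<integral>s. (1 - exp (c * a s)) * exp (g n s) \<partial>R)
        \<longlonglongrightarrow> (\<integral>s. (1 - exp (c * a s)) * f s \<partial>R)"
      using e by (intro limit_bounded(2)) auto
    moreover have "(\<lambda>n. (1/4) ^ n - c * (\<integral>s. a s * p s \<partial>R)) \<longlonglongrightarrow> 0 - c * (\<integral>s. a s * p s \<partial>R)"
      by (intro tendsto_diff tendsto_const LIMSEQ_power_zero) simp
    moreover have "(\<integral>s. (1 - exp (c * a s)) * exp (g n s) \<partial>R)
        \<le> (1/4) ^ n - c * (\<integral>s. a s * p s \<partial>R)" for n
    proof -
      have "(1 - exp (c * a s)) * exp (g n s) = exp (g n s) - exp (g n s + c * a s)" for s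
        by (simp add: algebra_simps flip: exp_add)
      then show ?thesis
        using J_near_min[OF g_V[of n] a, of c] near[of n] by simp
    qed
    ultimately have 1: "(\<integral>s. (1 - exp (c * a s)) * f s \<partial>R) \<le> - c * (\<integral>s. a s * p s \<partial>R)"
      by (intro LIMSEQ_le[of "\<lambda>n. \<integral>s. (1 - exp (c * a s)) * exp (g n s) \<partial>R"]) auto
    have "- (c * a s) - 2 * c\<^sup>2 * B\<^sup>2 \<le> 1 - exp (c * a s)" for s
    proof -
      have "(c * a s)\<^sup>2 \<le> (c * B)\<^sup>2"
        using ca[of s] by (rule abs_le_square_iff[THEN iffD1, OF order_trans]) simp
      then show ?thesis
        using exp_le_quadratic[OF ca'[of s]] by (simp add: power_mult_distrib)
    qed
    then have "(\<integral>s. (- (c * a s) - 2 * c\<^sup>2 * B\<^sup>2) * f s \<partial>R) \<le> (\<integral>s. (1 - exp (c * a s)) * f s \<partial>R)"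
    proof (intro integral_mono_AE)
      show "integrable R (\<lambda>s. (- (c * a s) - 2 * c\<^sup>2 * B\<^sup>2) * f s)"
        using V_mult_int[OF a f_int] f_int by (simp add: algebra_simps)
      show "integrable R (\<lambda>s. (1 - exp (c * a s)) * f s)"
        using e by (intro limit_bounded(1)) auto
    qed (use f_nonneg in \<open>auto intro: mult_right_mono\<close>)
    also have "(\<integral>s. (- (c * a s) - 2 * c\<^sup>2 * B\<^sup>2) * f s \<partial>R)
        = (\<integral>s. - c * (a s * f s) - 2 * c\<^sup>2 * B\<^sup>2 * f s \<partial>R)"
      by (intro Bochner_Integration.integral_cong) (auto simp: algebra_simps)
    also have "\<dots> = - c * (\<integral>s. a s * f s \<partial>R) - 2 * c\<^sup>2 * B\<^sup>2 * F"
      using V_mult_int[OF a f_int] f_int by (simp add: F_def)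
    finally have "c * (\<integral>s. a s * p s \<partial>R) \<le> c * ((\<integral>s. a s * f s \<partial>R) + 2 * c * B\<^sup>2 * F)"
      using 1 by (simp add: algebra_simps power2_eq_square)
    then show ?thesis using c(1) by simp
  qed
  define c where "c n = 1 / (2 * B) * inverse (real (Suc n))" for n
  have c: "0 < c n" "c n * B \<le> 1/2" for n
  proof -
    have "0 < B" using B(2) by linarith
    then show "0 < c n" by (simp add: c_def)
    have "c n * B = inverse (real (Suc n)) / 2" using \<open>0 < B\<close> by (simp add: c_def)
    also have "\<dots> \<le> 1/2" by (simp add: inverse_le_1_iff)
    finally show "c n * B \<le> 1/2" .
  qed
  have "c \<longlonglongrightarrow> 1 / (2 * B) * 0"
    unfolding c_def by (intro tendsto_mult tendsto_const LIMSEQ_inverse_real_of_nat)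
  then have "(\<lambda>n. (\<integral>s. a s * f s \<partial>R) + 2 * c n * B\<^sup>2 * F) \<longlonglongrightarrow> (\<integral>s. a s * f s \<partial>R) + 2 * (1 / (2 * B) * 0) * B\<^sup>2 * F"
    by (intro tendsto_intros)
  then show ?thesis
    using step[OF c] by (intro LIMSEQ_le_const) auto
qed

lemma moment_eq:
  assumes a: "a \<in> V"
  shows "(\<integral>s. a s * f s \<partial>R) = (\<integral>s. a s * p s \<partial>R)"
  using moment_le[OF a] moment_le[OF V_mult[OF a, of "- 1"]] by simp

lemma f_mass: "(\<integral>s. f s \<partial>R) = 1"
  using moment_eq[OF V_one] p_one by simp

lemma lim_moment: "(\<lambda>n. \<integral>s. g n s * p s \<partial>R) \<longlonglongrightarrow> 1 - m"
proof -
  have "(\<lambda>n. \<integral>s. exp (g n s) \<partial>R) \<longlonglongrightarrow> 1"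
    using limit_bounded(2)[of "\<lambda>s. 1" 1] by (simp add: f_mass)
  moreover have "(\<lambda>n. J (g n)) \<longlonglongrightarrow> m"
  proof (rule tendsto_sandwich[of "\<lambda>_. m"])
    show "(\<lambda>n. m + (1/4) ^ n) \<longlonglongrightarrow> m"
      using tendsto_add[OF tendsto_const[of m] LIMSEQ_power_zero[of "1/4 :: real"]] by simp
  qed (use m_le[OF g_V] near in auto)
  ultimately have "(\<lambda>n. (\<integral>s. exp (g n s) \<partial>R) - J (g n)) \<longlonglongrightarrow> 1 - m"
    by (rule tendsto_diff)
  then show ?thesis by (simp add: J_def)
qed

text \<open>
  Where \<open>f\<close> vanishes, \<open>g\<^sub>n \<rightarrow> -\<infinity>\<close>, and the Fenchel gap of \<open>p > 0\<close> at \<open>g\<^sub>n\<close> tends to \<open>\<infinity>\<close>; its integrals are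
  bounded.
\<close>

lemma f_pos: "AE s in R. 0 < f s"
proof -
  define H where "H = (\<integral>s. p s * ln (p s) \<partial>R)"
  let ?u = "\<lambda>n s. p s * ln (p s) - p s + exp (g n s) - g n s * p s"
  have "(\<integral>\<^sup>+s. liminf (\<lambda>n. ennreal (?u n s)) \<partial>R) \<le> liminf (\<lambda>n. \<integral>\<^sup>+s. ennreal (?u n s) \<partial>R)"
    by (rule nn_integral_liminf) measurable
  also have "\<dots> \<le> limsup (\<lambda>n. \<integral>\<^sup>+s. ennreal (?u n s) \<partial>R)"
    by (rule Liminf_le_Limsup) simp
  also have "\<dots> \<le> ennreal (H + m)"
  proof (rule Limsup_bounded, rule always_eventually, rule allI)
    fix n
    have int: "integrable R (?u n)"
      using g_V p_int p_ent by simp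
    have "(\<integral>s. ?u n s \<partial>R) = H - 1 + J (g n)"
      using g_V p_int p_ent p_one by (simp add: J_def H_def)
    also have "\<dots> \<le> H + m"
      using near[of n] power_le_one[of "1/4 :: real" n] by simp
    finally show "(\<integral>\<^sup>+s. ennreal (?u n s) \<partial>R) \<le> ennreal (H + m)"
      by (subst nn_integral_eq_integral[OF int AE_I2[OF entropy_fenchel(1)[OF p_nonneg]]])
        (rule ennreal_leI)
  qed
  finally have "(\<integral>\<^sup>+s. liminf (\<lambda>n. ennreal (?u n s)) \<partial>R) \<noteq> \<infinity>"
    by (auto simp: top_unique)
  then have "AE s in R. liminf (\<lambda>n. ennreal (?u n s)) \<noteq> \<infinity>"
    by (intro nn_integral_PInf_AE) measurable
  then show ?thesis
    using lim f_nonneg p_pos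
  proof eventually_elim
    case (elim s)
    show ?case
    proof (rule ccontr)
      assume "\<not> 0 < f s"
      then have "(\<lambda>n. exp (g n s)) \<longlonglongrightarrow> 0" using elim by auto
      then have "filterlim (\<lambda>n. exp (g n s)) (at_right 0) sequentially"
        by (intro tendsto_imp_filterlim_at_right) auto
      then have "filterlim (\<lambda>n. ln (exp (g n s))) at_bot sequentially"
        by (rule filterlim_compose[OF ln_at_0])
      then have "filterlim (\<lambda>n. - g n s) at_top sequentially"
        by (simp add: filterlim_uminus_at_bot)
      then have "filterlim (\<lambda>n. p s * (- g n s)) at_top sequentially"
        using elim by (intro filterlim_tendsto_pos_mult_at_top[OF tendsto_const]) auto
      then have "filterlim (\<lambda>n. (p s * ln (p s) - p s + exp (g n s)) + p s * (- g n s)) at_top sequentially"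
        by (rule filterlim_tendsto_add_at_top[OF tendsto_add[OF tendsto_const elim(2)]])
      then have "filterlim (\<lambda>n. ?u n s) at_top sequentially"
        by (simp add: algebra_simps)
      then have "(\<lambda>n. ennreal (?u n s)) \<longlonglongrightarrow> top"
        by (simp only: ennreal_tendsto_top_eq_at_top)
      then have "liminf (\<lambda>n. ennreal (?u n s)) = top"
        by (rule lim_imp_Liminf[OF sequentially_bot])
      then show False using elim by simp
    qed
  qed
qed

lemma lim_ln: "AE s in R. (\<lambda>n. g n s) \<longlonglongrightarrow> ln (f s)"
  using lim f_pos by eventually_elim (auto dest: tendsto_ln)

text \<open>
  Shrink \<open>g\<^sub>n\<close> by the factor \<open>1 - c\<^sub>n\<close>, where \<open>c\<^sub>n \<rightarrow> 0\<close> slower than the defect \<open>(1/4)\<^sup>n\<close> of \<open>J\<close>, and use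
  \<open>c\<^sub>n g\<^sub>n exp ((1 - c\<^sub>n) g\<^sub>n) \<le> exp g\<^sub>n - exp ((1 - c\<^sub>n) g\<^sub>n)\<close>.
\<close>

lemma f_entropy:
  shows "integrable R (\<lambda>s. f s * ln (f s))" and "(\<integral>s. f s * ln (f s) \<partial>R) \<le> 1 - m"
proof -
  define c :: "nat \<Rightarrow> real" where "c n = (1/2) ^ Suc n" for n
  have c: "0 < c n" "c n \<le> 1/2" for n
    using power_le_one[of "1/2 :: real" n] by (auto simp: c_def)
  have c_lim: "c \<longlonglongrightarrow> 0"
    unfolding c_def by (intro LIMSEQ_Suc LIMSEQ_power_zero) simp
  let ?v = "\<lambda>n s. g n s * exp ((1 - c n) * g n s)"
  have v_int: "integrable R (?v n)" for n
    by (intro V_mult_int exp_V_int g_V)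
  have v_ge: "- 2 \<le> ?v n s" for n s
  proof -
    have "1/2 \<le> 1 - c n" using c(2)[of n] by simp
    have "- 1 \<le> (1 - c n) * ?v n s"
      using mult_exp_ge[of "(1 - c n) * g n s"] by (simp add: mult.assoc)
    moreover have "(1 - c n) * ?v n s \<le> 1/2 * ?v n s" if "?v n s \<le> 0"
      using \<open>1/2 \<le> 1 - c n\<close> that by (rule mult_right_mono_neg)
    ultimately show ?thesis by (cases "?v n s \<le> 0") linarith+
  qed
  have le: "(\<integral>s. ?v n s + 2 \<partial>R) \<le> 2 * (1/2) ^ n + (\<integral>s. g n s * p s \<partial>R) + 2" for n
  proof -
    have "c n * ?v n s \<le> exp (g n s) - exp (g n s + (- c n) * g n s)" for s
    proof -
      have "exp ((1 - c n) * g n s) * (1 + c n * g n s) \<le> exp ((1 - c n) * g n s) * exp (c n * g n s)"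
        by (intro mult_left_mono) (use exp_ge_add_one_self in auto)
      also have "\<dots> = exp (g n s)" by (simp add: algebra_simps flip: exp_add)
      finally show ?thesis by (simp add: algebra_simps)
    qed
    then have "(\<integral>s. c n * ?v n s \<partial>R) \<le> (\<integral>s. exp (g n s) - exp (g n s + (- c n) * g n s) \<partial>R)"
      using g_V v_int V_add[OF g_V g_V, of n "- c n" n] by (intro integral_mono) auto
    also have "\<dots> \<le> (1/4) ^ n + c n * (\<integral>s. g n s * p s \<partial>R)"
      using J_near_min[OF g_V g_V, of n "- c n" n] near[of n] by simp
    also have "(1/4) ^ n = c n * (2 * (1/2 :: real) ^ n)"
      using power_mult_distrib[of "1/2 :: real" "1/2" n] by (simp add: c_def)
    finally have "c n * (\<integral>s. ?v n s \<partial>R) \<le> c n * (2 * (1/2) ^ n + (\<integral>s. g n s * p s \<partial>R))"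
      by (simp add: algebra_simps)
    then have "(\<integral>s. ?v n s \<partial>R) \<le> 2 * (1/2) ^ n + (\<integral>s. g n s * p s \<partial>R)"
      using c(1)[of n] by simp
    then show ?thesis using v_int by (simp add: prob_space)
  qed
  have lim_v: "AE s in R. (\<lambda>n. ?v n s + 2) \<longlonglongrightarrow> f s * ln (f s) + 2"
    using lim_ln f_pos
  proof eventually_elim
    case (elim s)
    have "(\<lambda>n. ?v n s + 2) \<longlonglongrightarrow> ln (f s) * exp ((1 - 0) * ln (f s)) + 2"
      by (intro tendsto_intros elim c_lim)
    then show ?case using elim by (simp add: mult.commute)
  qed
  have lim_c: "(\<lambda>n. 2 * (1/2) ^ n + (\<integral>s. g n s * p s \<partial>R) + 2) \<longlonglongrightarrow> 2 * 0 + (1 - m) + 2"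
    by (intro tendsto_intros lim_moment LIMSEQ_power_zero) simp
  have v_int': "integrable R (\<lambda>s. ?v n s + 2)" for n using v_int by simp
  have v_nn: "0 \<le> ?v n s + 2" for n s using v_ge[of n s] by linarith
  note fatou = fatou_real[OF v_int' v_nn _ lim_v le lim_c]
  have *: "integrable R (\<lambda>s. f s * ln (f s) + 2)" "(\<integral>s. f s * ln (f s) + 2 \<partial>R) \<le> 2 * 0 + (1 - m) + 2"
    by (rule fatou; measurable)+
  from *(1) have "integrable R (\<lambda>s. (f s * ln (f s) + 2) - 2)" by (intro Bochner_Integration.integrable_diff) auto
  then show "integrable R (\<lambda>s. f s * ln (f s))" by simp
  then show "(\<integral>s. f s * ln (f s) \<partial>R) \<le> 1 - m"
    using *(2) by (simp add: prob_space)
qed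

text \<open>
  The Pythagorean inequality: the integral of the Fenchel gap is the relative entropy of \<open>q\<close> with
  respect to \<open>f\<close>.
\<close>

lemma entropy_gap:
  assumes q: "integrable R q" "\<And>s. 0 \<le> q s" "integrable R (\<lambda>s. q s * ln (q s))"
    and mom: "\<And>a. a \<in> V \<Longrightarrow> (\<integral>s. a s * q s \<partial>R) = (\<integral>s. a s * p s \<partial>R)"
  shows "integrable R (\<lambda>s. q s * ln (q s) - q s + f s - ln (f s) * q s)"
    and "(\<integral>s. q s * ln (q s) - q s + f s - ln (f s) * q s \<partial>R) + (\<integral>s. f s * ln (f s) \<partial>R)
      \<le> (\<integral>s. q s * ln (q s) \<partial>R)"
proof -
  have [measurable]: "q \<in> borel_measurable R" using q by auto
  have q_one: "(\<integral>s. q s \<partial>R) = 1" using mom[OF V_one] p_one by simp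
  let ?u = "\<lambda>n s. q s * ln (q s) - q s + exp (g n s) - g n s * q s"
  let ?H = "\<integral>s. q s * ln (q s) \<partial>R"
  have u_int: "integrable R (?u n)" for n using q g_V by simp
  have u_eq: "(\<integral>s. ?u n s \<partial>R) = ?H - 1 + (\<integral>s. exp (g n s) \<partial>R) - (\<integral>s. g n s * p s \<partial>R)" for n
    using q g_V q_one mom[OF g_V] by simp
  have lim_u: "AE s in R. (\<lambda>n. ?u n s) \<longlonglongrightarrow> q s * ln (q s) - q s + f s - ln (f s) * q s"
    using lim lim_ln by eventually_elim (intro tendsto_intros)
  have "(\<lambda>n. \<integral>s. exp (g n s) \<partial>R) \<longlonglongrightarrow> 1"
    using limit_bounded(2)[of "\<lambda>s. 1" 1] by (simp add: f_mass)
  then have lim_c: "(\<lambda>n. ?H - 1 + (\<integral>s. exp (g n s) \<partial>R) - (\<integral>s. g n s * p s \<partial>R)) \<longlonglongrightarrow> ?H - 1 + 1 - (1 - m)"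
    by (intro tendsto_intros lim_moment)
  note fatou = fatou_real[OF u_int entropy_fenchel(1)[OF q(2)] _ lim_u eq_refl[OF u_eq] lim_c]
  show "integrable R (\<lambda>s. q s * ln (q s) - q s + f s - ln (f s) * q s)"
    by (rule fatou) measurable
  have "(\<integral>s. q s * ln (q s) - q s + f s - ln (f s) * q s \<partial>R) \<le> ?H - 1 + 1 - (1 - m)"
    by (rule fatou) measurable
  then show "(\<integral>s. q s * ln (q s) - q s + f s - ln (f s) * q s \<partial>R) + (\<integral>s. f s * ln (f s) \<partial>R) \<le> ?H"
    using f_entropy(2) by linarith
qed

end

section \<open>Separable functions on product spaces\<close>

text \<open>No relation between the two \<open>\<sigma>\<close>-algebras is needed here.\<close>

lemma absolutely_continuous_AE':
  assumes "absolutely_continuous M N" "AE s in M. P s" "space N \<subseteq> space M"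
  shows "AE s in N. P s"
proof -
  obtain A where "{s \<in> space M. \<not> P s} \<subseteq> A" "A \<in> null_sets M"
    using AE_E[OF assms(2)] by (metis null_setsI)
  then show ?thesis
    using assms(1,3) by (intro AE_I'[of A]) (auto simp: absolutely_continuous_def)
qed

text \<open>Resampling one coordinate leaves a product measure invariant.\<close>

lemma distr_fun_upd_PiM:
  assumes I: "finite I" "t \<in> I" and prob: "\<And>i. i \<in> I \<Longrightarrow> prob_space (M i)"
  shows "distr (PiM I M \<Otimes>\<^sub>M M t) (PiM I M) (\<lambda>(s, a). s(t := a)) = PiM I M"
proof -
  \<comment> \<open>the components outside \<open>I\<close> are arbitrary; replace them by a probability space\<close>
  define N where "N i = (if i \<in> I then M i else M t)" for i
  have N_prob: "prob_space (N i)" for i using prob I by (simp add: N_def)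
  have PiM_N: "PiM I M = PiM I N" by (intro PiM_cong) (auto simp: N_def)
  have N_t: "M t = N t" using I by (simp add: N_def)
  interpret Nt: prob_space "N t" by (rule N_prob)
  interpret N: product_prob_space N I
    by (simp add: N_prob product_prob_spaceI)
  have meas: "(\<lambda>(s, a). s(t := a)) \<in> PiM I N \<Otimes>\<^sub>M N t \<rightarrow>\<^sub>M PiM I N"
    unfolding split_def
    by (rule measurable_fun_upd[where J = I]) (use I in auto)
  show ?thesis
    unfolding PiM_N N_t
  proof (rule N.PiM_eqI[OF I(1)])
    fix A assume A: "\<And>i. i \<in> I \<Longrightarrow> A i \<in> sets (N i)"
    define A' where "A' = A(t := space (N t))"
    have A': "A' i \<in> sets (N i)" if "i \<in> I" for i using A that by (simp add: A'_def)
    have "(\<lambda>(s, a). s(t := a)) -` PiE I A \<inter> space (PiM I N \<Otimes>\<^sub>M N t) = PiE I A' \<times> A t"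
    proof (intro set_eqI iffI)
      fix z assume "z \<in> (\<lambda>(s, a). s(t := a)) -` PiE I A \<inter> space (PiM I N \<Otimes>\<^sub>M N t)"
      then obtain s a where z: "z = (s, a)" "s(t := a) \<in> PiE I A" "s \<in> PiE I (\<lambda>i. space (N i))" "a \<in> space (N t)"
        by (auto simp: space_pair_measure space_PiM)
      have "s i \<in> A' i" if "i \<in> I" for i
        using PiE_mem[OF z(2) that] PiE_mem[OF z(3) that] by (auto simp: A'_def split: if_splits)
      moreover have "a \<in> A t" using PiE_mem[OF z(2) I(2)] by simp
      ultimately show "z \<in> PiE I A' \<times> A t"
        using z by (auto simp: PiE_iff)
    next
      fix z assume "z \<in> PiE I A' \<times> A t"
      then obtain s a where z: "z = (s, a)" "s \<in> PiE I A'" "a \<in> A t" by auto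
      have a: "a \<in> space (N t)" using sets.sets_into_space[OF A[OF I(2)]] z(3) by auto
      have "s i \<in> space (N i)" if "i \<in> I" for i
        using PiE_mem[OF z(2) that] sets.sets_into_space[OF A'[OF that]] by auto
      then have "s \<in> PiE I (\<lambda>i. space (N i))" using z(2) by (auto simp: PiE_iff)
      moreover have "s(t := a) \<in> PiE I A"
      proof (rule PiE_I)
        fix i assume "i \<in> I"
        then show "(s(t := a)) i \<in> A i"
          using PiE_mem[OF z(2) \<open>i \<in> I\<close>] z(3) by (cases "i = t") (auto simp: A'_def)
      next
        fix i assume "i \<notin> I"
        then show "(s(t := a)) i = undefined"
          using PiE_arb[OF z(2)] I(2) by auto
      qed
      ultimately show "z \<in> (\<lambda>(s, a). s(t := a)) -` PiE I A \<inter> space (PiM I N \<Otimes>\<^sub>M N t)"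
        using z(1) a by (auto simp: space_pair_measure space_PiM)
    qed
    then have "emeasure (distr (PiM I N \<Otimes>\<^sub>M N t) (PiM I N) (\<lambda>(s, a). s(t := a))) (PiE I A)
        = emeasure (PiM I N \<Otimes>\<^sub>M N t) (PiE I A' \<times> A t)"
      using A I(1) by (subst emeasure_distr[OF meas]) (auto intro!: sets_PiM_I_finite)
    also have "\<dots> = emeasure (PiM I N) (PiE I A') * emeasure (N t) (A t)"
      using A A' I by (intro Nt.emeasure_pair_measure_Times sets_PiM_I_finite) auto
    also have "emeasure (PiM I N) (PiE I A') = (\<Prod>i\<in>I. emeasure (N i) (A' i))"
      using A' I by (intro N.emeasure_PiM) auto
    also have "\<dots> = (\<Prod>i\<in>I - {t}. emeasure (N i) (A i))"
      using I by (subst prod.remove[of _ t]) (auto simp: A'_def Nt.emeasure_space_1 intro!: prod.cong)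
    also have "\<dots> * emeasure (N t) (A t) = (\<Prod>i\<in>I. emeasure (N i) (A i))"
      using I by (subst (2) prod.remove[of _ t]) (auto simp: mult.commute)
    finally show "emeasure (distr (PiM I N \<Otimes>\<^sub>M N t) (PiM I N) (\<lambda>(s, a). s(t := a))) (PiE I A)
        = (\<Prod>i\<in>I. emeasure (N i) (A i))" .
  qed simp
qed

lemma measurable_fun_upd_PiM:
  "t \<in> I \<Longrightarrow> (\<lambda>(s, a). s(t := a)) \<in> PiM I M \<Otimes>\<^sub>M M t \<rightarrow>\<^sub>M PiM I M"
  unfolding split_def by (rule measurable_fun_upd[where J = I]) auto

lemma AE_fun_upd_PiM:
  assumes I: "finite I" "t \<in> I" and prob: "\<And>i. i \<in> I \<Longrightarrow> prob_space (M i)"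
    and P: "AE s in PiM I M. P s"
  shows "AE s in PiM I M. AE a in M t. P (s(t := a))"
proof -
  interpret PI: prob_space "PiM I M" by (intro prob_space_PiM prob)
  interpret Mt: prob_space "M t" by (intro prob I)
  interpret pair_sigma_finite "PiM I M" "M t" ..
  have "AE z in PiM I M \<Otimes>\<^sub>M M t. P ((\<lambda>(s, a). s(t := a)) z)"
  proof (rule AE_distrD[OF measurable_fun_upd_PiM[OF I(2)]])
    have eq: "distr (PiM I M \<Otimes>\<^sub>M M t) (PiM I M) (\<lambda>(s, a). s(t := a)) = PiM I M"
      by (rule distr_fun_upd_PiM[OF I prob])
    show "AE s in distr (PiM I M \<Otimes>\<^sub>M M t) (PiM I M) (\<lambda>(s, a). s(t := a)). P s"
      unfolding eq by (rule P)
  qed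
  from AE_pair[OF this] show ?thesis by simp
qed

lemma nn_integral_fun_upd_PiM:
  assumes I: "finite I" "t \<in> I" and prob: "\<And>i. i \<in> I \<Longrightarrow> prob_space (M i)"
    and h[measurable]: "h \<in> borel_measurable (PiM I M)"
  shows "(\<integral>\<^sup>+s. \<integral>\<^sup>+a. h (s(t := a)) \<partial>M t \<partial>PiM I M) = (\<integral>\<^sup>+s. h s \<partial>PiM I M)"
proof -
  interpret Mt: prob_space "M t" by (intro prob I)
  note upd = measurable_fun_upd_PiM[OF I(2), of M]
  have eq: "distr (PiM I M \<Otimes>\<^sub>M M t) (PiM I M) (\<lambda>(s, a). s(t := a)) = PiM I M"
    by (rule distr_fun_upd_PiM[OF I prob])
  have "(\<integral>\<^sup>+s. h s \<partial>PiM I M) = (\<integral>\<^sup>+s. h s \<partial>distr (PiM I M \<Otimes>\<^sub>M M t) (PiM I M) (\<lambda>(s, a). s(t := a)))"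
    unfolding eq ..
  also have "\<dots> = (\<integral>\<^sup>+z. h ((\<lambda>(s, a). s(t := a)) z) \<partial>(PiM I M \<Otimes>\<^sub>M M t))"
    by (intro nn_integral_distr upd) simp
  also have "\<dots> = (\<integral>\<^sup>+s. \<integral>\<^sup>+a. h ((\<lambda>(s, a). s(t := a)) (s, a)) \<partial>M t \<partial>PiM I M)"
    by (intro Mt.nn_integral_fst[symmetric] measurable_compose[OF upd]) simp
  finally show ?thesis by simp
qed

lemma sep_sum_fun_upd:
  assumes "t \<le> T"
  shows "sep_sum T x (s(t := a)) = sep_sum T x s + (x t a - x t (s t))"
proof -
  have "sep_sum T x r = x t (r t) + (\<Sum>i\<in>{..T} - {t}. x i (r i))" for r
    unfolding sep_sum_def using assms by (intro sum.remove) auto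
  moreover have "(\<Sum>i\<in>{..T} - {t}. x i ((s(t := a)) i)) = (\<Sum>i\<in>{..T} - {t}. x i (s i))"
    by (intro sum.cong) auto
  ultimately show ?thesis by simp
qed

lemma sep_sum_uminus: "sep_sum T (\<lambda>t a. - x t a) s = - sep_sum T x s"
  by (simp add: sep_sum_def sum_negf)

lemma sep_sum_measurable:
  assumes "\<And>t. t \<le> T \<Longrightarrow> (\<lambda>s. s t) \<in> N \<rightarrow>\<^sub>M M t" "\<And>t. t \<le> T \<Longrightarrow> x t \<in> borel_measurable (M t)"
  shows "sep_sum T x \<in> borel_measurable N"
  unfolding sep_sum_def
  by (intro borel_measurable_sum measurable_compose[OF assms(1) assms(2)]) auto

lemma sep_sum_measurable_PiM:
  assumes "\<And>t. t \<le> T \<Longrightarrow> x t \<in> borel_measurable (M t)"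
  shows "sep_sum T x \<in> borel_measurable (PiM {..T} M)"
  by (rule sep_sum_measurable[of T _ M]) (auto intro: assms)

text \<open>
  The closedness of sums of functions of one coordinate under almost everywhere convergence. The
  hypothesis \<open>marg\<close> holds when \<open>R\<close> is absolutely continuous with respect to a measure with marginals
  \<open>M t\<close>.
\<close>

lemma separable_limit:
  fixes M :: "nat \<Rightarrow> 'a measure" and gs :: "nat \<Rightarrow> nat \<Rightarrow> 'a \<Rightarrow> real"
  assumes prob: "\<And>t. t \<le> T \<Longrightarrow> prob_space (M t)"
    and meas: "\<And>n t. t \<le> T \<Longrightarrow> gs n t \<in> borel_measurable (M t)"
    and lim: "AE s in R. (\<lambda>n. sep_sum T (gs n) s) \<longlonglongrightarrow> G s"
    and ac: "absolutely_continuous R (PiM {..T} M)" "space (PiM {..T} M) \<subseteq> space R"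
    and marg: "\<And>t P. t \<le> T \<Longrightarrow> AE a in M t. P a \<Longrightarrow> AE s in R. P (s t)"
  shows "\<exists>x. (\<forall>t\<le>T. x t \<in> borel_measurable (M t)) \<and> (AE s in R. G s = sep_sum T x s)"
proof -
  define conv where "conv s = convergent (\<lambda>n. sep_sum T (gs n) s)" for s
  interpret PI: prob_space "PiM {..T} M" by (intro prob_space_PiM prob) auto
  have "AE s in R. conv s"
    using lim by eventually_elim (auto simp: conv_def convergent_def)
  then have AE_conv: "AE s in PiM {..T} M. conv s"
    by (rule absolutely_continuous_AE'[OF ac(1) _ ac(2)])
  then have "AE s in PiM {..T} M. AE a in M t. conv (s(t := a))" if "t \<in> {..T}" for t
    using that prob by (intro AE_fun_upd_PiM) auto
  then have "AE s in PiM {..T} M. \<forall>t\<in>{..T}. AE a in M t. conv (s(t := a))"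
    by (intro AE_finite_allI) auto
  with AE_conv have "AE s in PiM {..T} M. conv s \<and> (\<forall>t\<in>{..T}. AE a in M t. conv (s(t := a)))"
    by eventually_elim simp
  \<comment> \<open>the reference point\<close>
  from eventually_happens'[OF PI.ae_filter_bot this]
  obtain s0 where s0: "conv s0" "\<And>t. t \<le> T \<Longrightarrow> AE a in M t. conv (s0(t := a))"
    by auto
  define d where "d t n a = gs n t a - gs n t (s0 t)" for t n a
  define c where "c = lim (\<lambda>n. sep_sum T (gs n) s0)"
  \<comment> \<open>the constant is put into the coordinate \<open>0\<close>\<close>
  define x where "x t a = lim (\<lambda>n. d t n a) + (if t = 0 then c else 0)" for t a
  have conv_d: "AE a in M t. convergent (\<lambda>n. d t n a)" if t: "t \<le> T" for t
    using s0(2)[OF t]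
  proof eventually_elim
    case (elim a)
    then have "convergent (\<lambda>n. sep_sum T (gs n) (s0(t := a)) - sep_sum T (gs n) s0)"
      using s0(1) unfolding conv_def by (intro convergent_diff)
    then show ?case by (simp add: sep_sum_fun_upd[OF t] d_def)
  qed
  have "AE s in R. \<forall>t\<in>{..T}. convergent (\<lambda>n. d t n (s t))"
    using marg[OF _ conv_d] by (intro AE_finite_allI) auto
  with lim have "AE s in R. G s = sep_sum T x s"
  proof eventually_elim
    case (elim s)
    have eq: "sep_sum T (gs n) s = sep_sum T (gs n) s0 + (\<Sum>t\<le>T. d t n (s t))" for n
      by (simp add: sep_sum_def d_def sum_subtractf)
    have "(\<lambda>n. sep_sum T (gs n) s0) \<longlonglongrightarrow> c"
      using s0(1) by (simp add: c_def conv_def convergent_LIMSEQ_iff)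
    moreover have "(\<lambda>n. \<Sum>t\<le>T. d t n (s t)) \<longlonglongrightarrow> (\<Sum>t\<le>T. lim (\<lambda>n. d t n (s t)))"
      using elim by (intro tendsto_sum) (auto simp: convergent_LIMSEQ_iff)
    ultimately have "(\<lambda>n. sep_sum T (gs n) s) \<longlonglongrightarrow> c + (\<Sum>t\<le>T. lim (\<lambda>n. d t n (s t)))"
      unfolding eq by (rule tendsto_add)
    also have "c + (\<Sum>t\<le>T. lim (\<lambda>n. d t n (s t))) = sep_sum T x s"
      by (simp add: sep_sum_def x_def sum.distrib sum.delta)
    finally show ?case
      using elim(1) LIMSEQ_unique by blast
  qed
  moreover have "x t \<in> borel_measurable (M t)" if "t \<le> T" for t
  proof -
    have [measurable]: "d t n \<in> borel_measurable (M t)" for n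
      unfolding d_def using meas[OF that] by measurable
    show ?thesis unfolding x_def by measurable
  qed
  ultimately show ?thesis by blast
qed

text \<open>
  By Fubini's theorem, \<open>x t\<close> plus some constant has integrable positive part.
\<close>

lemma nn_integral_component_finite:
  fixes M :: "nat \<Rightarrow> 'a measure"
  assumes prob: "\<And>t. t \<le> T \<Longrightarrow> prob_space (M t)"
    and meas: "\<And>t. t \<le> T \<Longrightarrow> x t \<in> borel_measurable (M t)"
    and fin: "(\<integral>\<^sup>+s. ennreal (sep_sum T x s) \<partial>PiM {..T} M) < \<infinity>" and t: "t \<le> T"
  shows "(\<integral>\<^sup>+a. ennreal (x t a) \<partial>M t) < \<infinity>"
proof -
  interpret PI: prob_space "PiM {..T} M" by (intro prob_space_PiM prob) auto
  interpret Mt: prob_space "M t" by (intro prob t)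
  note [measurable] = meas[OF t] and upd[measurable] = measurable_fun_upd_PiM[of t "{..T}" M]
  have [measurable]: "sep_sum T x \<in> borel_measurable (PiM {..T} M)"
    by (rule sep_sum_measurable_PiM[OF meas])
  have h: "(\<lambda>s. ennreal (sep_sum T x s)) \<in> borel_measurable (PiM {..T} M)" by measurable
  have "(\<lambda>z. ennreal (sep_sum T x ((\<lambda>(s, a). s(t := a)) z))) \<in> borel_measurable (PiM {..T} M \<Otimes>\<^sub>M M t)"
    using t by (intro measurable_compose[OF upd h]) auto
  then have "(\<lambda>s. \<integral>\<^sup>+a. ennreal (sep_sum T x (s(t := a))) \<partial>M t) \<in> borel_measurable (PiM {..T} M)"
    by (auto dest!: Mt.borel_measurable_nn_integral_fst)
  moreover have "(\<integral>\<^sup>+s. \<integral>\<^sup>+a. ennreal (sep_sum T x (s(t := a))) \<partial>M t \<partial>PiM {..T} M) \<noteq> \<infinity>"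
    using fin t by (subst nn_integral_fun_upd_PiM[OF _ _ prob h]) auto
  ultimately have "AE s in PiM {..T} M. (\<integral>\<^sup>+a. ennreal (sep_sum T x (s(t := a))) \<partial>M t) \<noteq> \<infinity>"
    by (rule nn_integral_PInf_AE)
  from eventually_happens'[OF PI.ae_filter_bot this]
  obtain s where s: "(\<integral>\<^sup>+a. ennreal (sep_sum T x (s(t := a))) \<partial>M t) \<noteq> \<infinity>"
    by auto
  define c where "c = sep_sum T x s - x t (s t)"
  have eq: "sep_sum T x (s(t := a)) = x t a + c" for a
    by (simp add: sep_sum_fun_upd[OF t] c_def)
  have "(\<integral>\<^sup>+a. ennreal (x t a) \<partial>M t) \<le> (\<integral>\<^sup>+a. ennreal (x t a + c) + ennreal \<bar>c\<bar> \<partial>M t)"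
  proof (rule nn_integral_mono)
    fix a
    have "ennreal (x t a) \<le> ennreal (max 0 (x t a + c) + \<bar>c\<bar>)" by (intro ennreal_leI) auto
    also have "\<dots> = ennreal (max 0 (x t a + c)) + ennreal \<bar>c\<bar>" by (rule ennreal_plus) auto
    also have "ennreal (max 0 (x t a + c)) = ennreal (x t a + c)" by (auto simp: max_def ennreal_neg)
    finally show "ennreal (x t a) \<le> ennreal (x t a + c) + ennreal \<bar>c\<bar>" .
  qed
  also have "\<dots> = (\<integral>\<^sup>+a. ennreal (x t a + c) \<partial>M t) + ennreal \<bar>c\<bar>"
    by (subst nn_integral_add) (auto simp: Mt.emeasure_space_1)
  also have "\<dots> < \<infinity>"
    using s unfolding eq by (simp add: less_top)
  finally show ?thesis .
qed

lemma integrable_component: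
  fixes M :: "nat \<Rightarrow> 'a measure"
  assumes prob: "\<And>t. t \<le> T \<Longrightarrow> prob_space (M t)"
    and meas: "\<And>t. t \<le> T \<Longrightarrow> x t \<in> borel_measurable (M t)"
    and int: "integrable (PiM {..T} M) (sep_sum T x)" and t: "t \<le> T"
  shows "integrable (M t) (x t)"
proof -
  have "(\<integral>\<^sup>+a. ennreal (x t a) \<partial>M t) < \<infinity>"
    using int by (intro nn_integral_component_finite[OF prob meas _ t]) (auto simp: real_integrable_def less_top)
  moreover have "(\<integral>\<^sup>+a. ennreal (- x t a) \<partial>M t) < \<infinity>"
    using int meas
    by (intro nn_integral_component_finite[where x = "\<lambda>t a. - x t a", OF prob _ _ t])
      (auto simp: real_integrable_def less_top sep_sum_uminus)
  ultimately show ?thesis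
    using meas[OF t] by (auto simp: real_integrable_def)
qed

section \<open>Integrals of sums under measures with equal marginals\<close>

text \<open>Truncation to the interval \<open>[-n, n]\<close>.\<close>

definition clip :: "nat \<Rightarrow> real \<Rightarrow> real" where
  "clip n v = max (- real n) (min (real n) v)"

lemma clip_measurable[measurable]: "clip n \<in> borel_measurable borel"
  unfolding clip_def by measurable

lemma abs_clip_le: "\<bar>clip n v\<bar> \<le> real n"
  by (auto simp: clip_def)

lemma clip_tendsto: "(\<lambda>n. clip n v) \<longlonglongrightarrow> v"
proof (rule tendsto_eventually)
  obtain N where "\<bar>v\<bar> \<le> real N" using real_arch_simple by blast
  then show "\<forall>\<^sub>F n in sequentially. clip n v = v"
    by (intro eventually_sequentiallyI[of N]) (auto simp: clip_def)
qed

text \<open>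
  The sum of two (but not of three) clipped numbers lies between \<open>0\<close> and the sum of the numbers: for opposite
  signs because clipping is odd, monotone and nonexpansive, for equal signs because it moves towards \<open>0\<close>.
\<close>

lemma clip_add_bounds:
  "\<bar>clip n u + clip n v\<bar> \<le> \<bar>u + v\<bar>"
  "max 0 (clip n u + clip n v) \<le> max 0 (u + v)"
  "max 0 (- (clip n u + clip n v)) \<le> max 0 (- (u + v))"
  by (auto simp: clip_def)

text \<open>
  The integral of \<open>U + V\<close> is determined by the laws of \<open>U\<close> and \<open>V\<close> even if these are not integrable,
  provided that \<open>U + V\<close> is integrable under one measure and its positive part under the other.
\<close>

lemma integral_add_eq_of_clip:
  fixes U V :: "'b \<Rightarrow> real"
  assumes fin: "finite_measure M" "finite_measure N"
    and UV[measurable]: "U \<in> borel_measurable M" "V \<in> borel_measurable M"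
      "U \<in> borel_measurable N" "V \<in> borel_measurable N"
    and U_eq: "\<And>n. (\<integral>s. clip n (U s) \<partial>M) = (\<integral>s. clip n (U s) \<partial>N)"
    and V_eq: "\<And>n. (\<integral>s. clip n (V s) \<partial>M) = (\<integral>s. clip n (V s) \<partial>N)"
    and M: "integrable M (\<lambda>s. U s + V s)" and N: "integrable N (\<lambda>s. max 0 (U s + V s))"
  shows "integrable N (\<lambda>s. U s + V s)" and "(\<integral>s. U s + V s \<partial>N) = (\<integral>s. U s + V s \<partial>M)"
proof -
  interpret M: finite_measure M by fact
  interpret N: finite_measure N by fact
  define G where "G n s = clip n (U s) + clip n (V s)" for n s
  define g where "g s = U s + V s" for s
  have G_meas[measurable]: "G n \<in> borel_measurable M" "G n \<in> borel_measurable N" for n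
    unfolding G_def by measurable
  have g_meas[measurable]: "g \<in> borel_measurable M" "g \<in> borel_measurable N"
    unfolding g_def by measurable
  have lim: "(\<lambda>n. G n s) \<longlonglongrightarrow> g s" for s
    unfolding G_def g_def by (intro tendsto_add clip_tendsto)
  have clip_int: "integrable M (\<lambda>s. clip n (U s))" "integrable M (\<lambda>s. clip n (V s))"
     "integrable N (\<lambda>s. clip n (U s))" "integrable N (\<lambda>s. clip n (V s))" for n
    by (auto intro!: M.integrable_const_bound[where B = n] N.integrable_const_bound[where B = n]
        simp: abs_clip_le)
  have G_eq: "(\<integral>s. G n s \<partial>N) = (\<integral>s. G n s \<partial>M)" for n
    unfolding G_def using U_eq V_eq by (simp add: clip_int)
  have G_int: "integrable N (G n)" for n unfolding G_def using clip_int by auto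
  have lim_M: "(\<lambda>n. \<integral>s. G n s \<partial>M) \<longlonglongrightarrow> (\<integral>s. g s \<partial>M)"
    by (rule integral_dominated_convergence[where w = "\<lambda>s. \<bar>g s\<bar>"])
      (use M lim clip_add_bounds(1) in \<open>auto simp: G_def g_def\<close>)
  have lim_N: "(\<lambda>n. \<integral>s. max 0 (G n s) \<partial>N) \<longlonglongrightarrow> (\<integral>s. max 0 (g s) \<partial>N)"
  proof (rule integral_dominated_convergence[where w = "\<lambda>s. max 0 (g s)"])
    show "AE s in N. (\<lambda>n. max 0 (G n s)) \<longlonglongrightarrow> max 0 (g s)"
      by (intro AE_I2 tendsto_max tendsto_const lim)
    show "AE s in N. norm (max 0 (G n s)) \<le> max 0 (g s)" for n
      using clip_add_bounds(2) by (auto simp: G_def g_def)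
  qed (use N in \<open>auto simp: g_def\<close>)
  have "integrable N (\<lambda>s. max 0 (- g s))"
  proof (rule fatou_real(1))
    show "integrable N (\<lambda>s. max 0 (- G n s))" for n using G_int by auto
    show "AE s in N. (\<lambda>n. max 0 (- G n s)) \<longlonglongrightarrow> max 0 (- g s)"
      by (intro AE_I2 tendsto_max tendsto_const tendsto_minus lim)
    show "(\<lambda>n. (\<integral>s. max 0 (G n s) \<partial>N) - (\<integral>s. G n s \<partial>M)) \<longlonglongrightarrow> (\<integral>s. max 0 (g s) \<partial>N) - (\<integral>s. g s \<partial>M)"
      by (intro tendsto_diff lim_N lim_M)
    show "(\<integral>s. max 0 (- G n s) \<partial>N) \<le> (\<integral>s. max 0 (G n s) \<partial>N) - (\<integral>s. G n s \<partial>M)" for n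
    proof -
      have "(\<integral>s. max 0 (- G n s) \<partial>N) = (\<integral>s. max 0 (G n s) - G n s \<partial>N)"
        by (intro Bochner_Integration.integral_cong) auto
      also have "\<dots> = (\<integral>s. max 0 (G n s) \<partial>N) - (\<integral>s. G n s \<partial>N)"
        using G_int by (intro Bochner_Integration.integral_diff) auto
      finally show ?thesis by (simp add: G_eq)
    qed
  qed auto
  then have "integrable N (\<lambda>s. max 0 (g s) - max 0 (- g s))"
    using N unfolding g_def by (intro Bochner_Integration.integrable_diff) auto
  also have "(\<lambda>s. max 0 (g s) - max 0 (- g s)) = g" by auto
  finally have g_int: "integrable N g" .
  then show "integrable N (\<lambda>s. U s + V s)" by (simp add: g_def[abs_def])
  have "(\<lambda>n. \<integral>s. G n s \<partial>N) \<longlonglongrightarrow> (\<integral>s. g s \<partial>N)"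
    by (rule integral_dominated_convergence[where w = "\<lambda>s. \<bar>g s\<bar>"])
      (use g_int lim clip_add_bounds(1) in \<open>auto simp: G_def g_def[abs_def]\<close>)
  then show "(\<integral>s. U s + V s \<partial>N) = (\<integral>s. U s + V s \<partial>M)"
    using lim_M unfolding G_eq g_def by (rule LIMSEQ_unique)
qed

section \<open>Densities of feasible measures\<close>

lemma space_borel_of: "space (borel_of X) = topspace X"
  unfolding borel_of_def by (rule space_measure_of) (auto dest: openin_subset)

lemma continuous_map_borel_of:
  assumes "continuous_map X Y f"
  shows "f \<in> borel_of X \<rightarrow>\<^sub>M borel_of Y"
proof -
  have sets: "sets (borel_of X) = sigma_sets (topspace X) {U. openin X U}"
    unfolding borel_of_def by (rule sets_measure_of) (auto dest: openin_subset)
  show ?thesis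
    unfolding borel_of_def[of Y]
  proof (rule measurable_measure_of)
    show "{U. openin Y U} \<subseteq> Pow (topspace Y)" by (auto dest: openin_subset)
    show "f \<in> space (borel_of X) \<rightarrow> topspace Y"
      using continuous_map_image_subset_topspace[OF assms] by (auto simp: space_borel_of)
    show "f -` U \<inter> space (borel_of X) \<in> sets (borel_of X)" if "U \<in> {U. openin Y U}" for U
    proof -
      have "openin X {a \<in> topspace X. f a \<in> U}"
        using assms that by (auto intro: openin_continuous_map_preimage)
      moreover have "f -` U \<inter> space (borel_of X) = {a \<in> topspace X. f a \<in> U}"
        by (auto simp: space_borel_of)
      ultimately show ?thesis by (auto simp: sets)
    qed
  qed
qed

lemma SP_objective_density:
  assumes "finite_measure R" and p[measurable]: "p \<in> borel_measurable R" and nn: "\<And>s. 0 \<le> p s"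
  shows "SP_objective R (density R p) =
    (if integrable R (\<lambda>s. p s * ln (p s)) then ereal (\<integral>s. p s * ln (p s) \<partial>R) else \<infinity>)"
proof -
  interpret R: finite_measure R by fact
  let ?h = "\<lambda>s. p s * ln (p s)"
  let ?r = "RN_deriv R (density R p)"
  have "AE s in R. ennreal (p s) = ?r s" by (rule R.RN_deriv_unique) auto
  then have "AE s in density R p. ennreal (p s) = ?r s"
    by (subst AE_density) auto
  then have rn: "AE s in density R p. ln (enn2real (?r s)) = ln (p s)"
    by eventually_elim (metis enn2real_ennreal nn)
  have pos: "(\<integral>\<^sup>+s. ennreal (ln (enn2real (?r s))) \<partial>density R p) = (\<integral>\<^sup>+s. ennreal (?h s) \<partial>R)"
  proof -
    have "(\<integral>\<^sup>+s. ennreal (ln (enn2real (?r s))) \<partial>density R p) = (\<integral>\<^sup>+s. ennreal (ln (p s)) \<partial>density R p)"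
      using rn by (intro nn_integral_cong_AE) auto
    also have "\<dots> = (\<integral>\<^sup>+s. ennreal (?h s) \<partial>R)"
      by (simp add: nn_integral_density ennreal_mult' nn)
    finally show ?thesis .
  qed
  have neg: "(\<integral>\<^sup>+s. ennreal (- ln (enn2real (?r s))) \<partial>density R p) = (\<integral>\<^sup>+s. ennreal (- ?h s) \<partial>R)"
  proof -
    have "(\<integral>\<^sup>+s. ennreal (- ln (enn2real (?r s))) \<partial>density R p) = (\<integral>\<^sup>+s. ennreal (- ln (p s)) \<partial>density R p)"
      using rn by (intro nn_integral_cong_AE) auto
    also have "\<dots> = (\<integral>\<^sup>+s. ennreal (- ?h s) \<partial>R)"
      by (simp add: nn_integral_density nn flip: ennreal_mult')
    finally show ?thesis .
  qed
  have "(\<integral>\<^sup>+s. ennreal (- ?h s) \<partial>R) \<le> (\<integral>\<^sup>+s. 1 \<partial>R)"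
    using entropy_ge[OF nn] by (intro nn_integral_mono) (simp add: minus_le_iff)
  also have "\<dots> < \<infinity>" by (simp flip: less_top)
  finally have neg_fin: "(\<integral>\<^sup>+s. ennreal (- ?h s) \<partial>R) < \<infinity>" .
  show ?thesis
  proof (cases "(\<integral>\<^sup>+s. ennreal (?h s) \<partial>R) < \<infinity>")
    case True
    then have int: "integrable R ?h" using neg_fin by (auto simp: real_integrable_def)
    have e: "enn2ereal A = ereal (enn2real A)" if "A < \<infinity>" for A
      using that by (cases A) (auto simp: enn2ereal_ennreal)
    show ?thesis
      unfolding SP_objective_def ext_integral_def pos neg
      using True neg_fin int by (simp add: e real_lebesgue_integral_def)
  next
    case False
    then have "\<not> integrable R ?h" by (auto simp: real_integrable_def less_top)
    then show ?thesis
      unfolding SP_objective_def ext_integral_def pos neg using False by simp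
  qed
qed

text \<open>
  The problem of minimizing the entropy relative to \<open>R\<close> under the marginals \<open>\<mu> t\<close>.
\<close>

locale schrodinger =
  fixes T :: nat and S :: "nat \<Rightarrow> 'a topology" and \<psi> :: "nat \<Rightarrow> 'a \<Rightarrow> real"
    and R :: "(nat \<Rightarrow> 'a) measure" and \<mu> :: "nat \<Rightarrow> 'a measure"
  assumes R_weighted: "R \<in> weighted_measures (prod_space T S) (sep_sum T \<psi>)"
    and R_prob: "prob_space R"
    and mu_weighted: "\<And>t. t \<le> T \<Longrightarrow> \<mu> t \<in> weighted_measures (S t) (\<psi> t)"
    and mu_prob: "\<And>t. t \<le> T \<Longrightarrow> prob_space (\<mu> t)"
begin

sublocale R: prob_space R by (rule R_prob)

lemma sets_R: "sets R = sets (borel_of (prod_space T S))"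
  using R_weighted by (simp add: weighted_measures_def)

lemma sets_mu: "t \<le> T \<Longrightarrow> sets (\<mu> t) = sets (borel_of (S t))"
  using mu_weighted by (simp add: weighted_measures_def)

lemma measurable_mu: "t \<le> T \<Longrightarrow> measurable (\<mu> t) N = measurable (borel_of (S t)) N"
  by (intro measurable_cong_sets sets_mu) auto

lemma proj_meas: "t \<le> T \<Longrightarrow> (\<lambda>s. s t) \<in> R \<rightarrow>\<^sub>M borel_of (S t)"
  unfolding measurable_cong_sets[OF sets_R refl] prod_space_def
  by (intro continuous_map_borel_of continuous_map_product_projection) auto

lemma space_PiM_mu: "space (PiM {..T} \<mu>) = space R"
  using sets_eq_imp_space_eq[OF sets_R] sets_eq_imp_space_eq[OF sets_mu]
  by (auto simp: space_PiM space_borel_of prod_space_def topspace_product_topology intro!: PiE_cong)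

lemma sep_sum_meas_R:
  "(\<And>t. t \<le> T \<Longrightarrow> x t \<in> borel_measurable (borel_of (S t))) \<Longrightarrow> sep_sum T x \<in> borel_measurable R"
  by (rule sep_sum_measurable[OF proj_meas])

text \<open>
  The densities of the feasible measures. Integrability of \<open>p ln p\<close> amounts to a finite objective value,
  because the negative part of \<open>p ln p\<close> is bounded; the weight \<open>\<psi>\<close> is integrable because its summands are
  integrable under the marginals.
\<close>

definition feasible_density :: "((nat \<Rightarrow> 'a) \<Rightarrow> real) \<Rightarrow> bool" where
  "feasible_density p \<longleftrightarrow> (\<forall>s. 0 \<le> p s) \<and> integrable R p \<and> integrable R (\<lambda>s. p s * ln (p s)) \<and>
     (\<forall>t\<le>T. marginal S (density R p) t = \<mu> t)"

text \<open>The entropy of the measure with density \<open>p\<close> relative to \<open>R\<close>.\<close>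

definition H :: "((nat \<Rightarrow> 'a) \<Rightarrow> real) \<Rightarrow> real" where
  "H p = (\<integral>s. p s * ln (p s) \<partial>R)"

lemma feasible_densityD:
  assumes "feasible_density p"
  shows "\<And>s. 0 \<le> p s" "integrable R p" "p \<in> borel_measurable R"
    "integrable R (\<lambda>s. p s * ln (p s))" "\<And>t. t \<le> T \<Longrightarrow> marginal S (density R p) t = \<mu> t"
  using assms by (auto simp: feasible_density_def)

lemma objective_density:
  "feasible_density p \<Longrightarrow> SP_objective R (density R p) = ereal (H p)"
  by (subst SP_objective_density)
    (auto simp: feasible_density_def H_def R.finite_measure_axioms)

lemma marginal_integral:
  fixes x :: "'a \<Rightarrow> real"
  assumes t: "t \<le> T" and sets: "sets \<nu> = sets R" and marg: "marginal S \<nu> t = \<mu> t"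
    and x: "x \<in> borel_measurable (borel_of (S t))"
  shows "integrable \<nu> (\<lambda>s. x (s t)) \<longleftrightarrow> integrable (\<mu> t) x"
    and "(\<integral>s. x (s t) \<partial>\<nu>) = (\<integral>a. x a \<partial>\<mu> t)"
proof -
  have proj: "(\<lambda>s. s t) \<in> \<nu> \<rightarrow>\<^sub>M borel_of (S t)"
    using proj_meas[OF t] by (simp add: measurable_cong_sets[OF sets refl])
  show "integrable \<nu> (\<lambda>s. x (s t)) \<longleftrightarrow> integrable (\<mu> t) x"
    unfolding marg[symmetric] marginal_def by (rule integrable_distr_eq[OF proj x, symmetric])
  show "(\<integral>s. x (s t) \<partial>\<nu>) = (\<integral>a. x a \<partial>\<mu> t)"
    unfolding marg[symmetric] marginal_def by (rule integral_distr[OF proj x, symmetric])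
qed

lemma feasible_imp_density:
  assumes "SP_feasible T S \<psi> R \<mu> \<nu>"
  shows "\<exists>p. feasible_density p \<and> \<nu> = density R p \<and> (\<forall>s. p s = enn2real (RN_deriv R \<nu> s))"
proof -
  have sets: "sets \<nu> = sets R" and fin: "finite_measure \<nu>" and ac: "absolutely_continuous R \<nu>"
    and marg: "\<And>t. t \<le> T \<Longrightarrow> marginal S \<nu> t = \<mu> t" and obj: "SP_objective R \<nu> < \<infinity>"
    using assms by (auto simp: SP_feasible_def weighted_measures_def sets_R)
  interpret \<nu>: finite_measure \<nu> by fact
  let ?p = "\<lambda>s. enn2real (RN_deriv R \<nu> s)"
  have "AE s in R. RN_deriv R \<nu> s \<noteq> \<infinity>"
    by (rule R.RN_deriv_finite[OF _ ac sets]) unfold_locales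
  then have "AE s in R. RN_deriv R \<nu> s = ennreal (?p s)"
    by eventually_elim (auto simp: less_top)
  then have "density R (RN_deriv R \<nu>) = density R ?p"
    by (intro density_cong) auto
  then have eq: "\<nu> = density R ?p"
    using R.density_RN_deriv[OF ac sets] by simp
  have "(\<integral>\<^sup>+s. ennreal (?p s) \<partial>R) = emeasure \<nu> (space \<nu>)"
    by (subst (2) eq, subst (3) eq) (simp add: emeasure_density cong: nn_integral_cong)
  then have int: "integrable R ?p"
    by (intro integrableI_nonneg) (simp_all add: less_top[symmetric])
  have "integrable R (\<lambda>s. ?p s * ln (?p s))"
    using obj SP_objective_density[OF R.finite_measure_axioms, of ?p] eq[symmetric]
    by (auto split: if_splits)
  then have "feasible_density ?p"
    using int marg eq[symmetric] by (auto simp: feasible_density_def)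
  then show ?thesis using eq by blast
qed

lemma psi_meas: "t \<le> T \<Longrightarrow> \<psi> t \<in> borel_measurable (borel_of (S t))"
  using mu_weighted[of t] measurable_mu[of t borel] by (auto simp: weighted_measures_def)

lemma density_imp_feasible:
  assumes p: "feasible_density p"
  shows "SP_feasible T S \<psi> R \<mu> (density R p)"
proof -
  note p' = feasible_densityD[OF p]
  have "integrable (density R p) (\<lambda>s. \<psi> t (s t))" if "t \<le> T" for t
    using marginal_integral(1)[OF that _ p'(5)[OF that] psi_meas[OF that]] mu_weighted[OF that]
    by (simp add: weighted_measures_def)
  then have "integrable (density R p) (sep_sum T \<psi>)"
    unfolding sep_sum_def by (intro Bochner_Integration.integrable_sum) auto
  moreover have "finite_measure (density R p)"
  proof (rule finite_measureI)
    have "emeasure (density R p) (space (density R p)) = (\<integral>\<^sup>+s. ennreal (p s) \<partial>R)"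
      using p' by (simp add: emeasure_density cong: nn_integral_cong)
    then show "emeasure (density R p) (space (density R p)) \<noteq> \<infinity>"
      using p'(1,2) by (simp add: nn_integral_eq_integral)
  qed
  moreover have "absolutely_continuous R (density R p)"
    using p' by (intro absolutely_continuousI_density) auto
  ultimately show ?thesis
    using p'(5) objective_density[OF p] by (simp add: SP_feasible_def weighted_measures_def sets_R)
qed

lemma moment:
  assumes p: "feasible_density p" and t: "t \<le> T" and x: "x \<in> borel_measurable (borel_of (S t))"
    and int: "integrable (\<mu> t) x"
  shows "integrable R (\<lambda>s. x (s t) * p s)" and "(\<integral>s. x (s t) * p s \<partial>R) = (\<integral>a. x a \<partial>\<mu> t)"
proof -
  note p' = feasible_densityD[OF p]
  have meas: "(\<lambda>s. x (s t)) \<in> borel_measurable R" by (rule measurable_compose[OF proj_meas[OF t] x])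
  note m = marginal_integral[OF t _ p'(5)[OF t] x]
  show "integrable R (\<lambda>s. x (s t) * p s)"
    using m(1) int integrable_real_density[OF p'(3) AE_I2[OF p'(1)] meas] by (simp add: mult.commute)
  show "(\<integral>s. x (s t) * p s \<partial>R) = (\<integral>a. x a \<partial>\<mu> t)"
    using m(2) integral_real_density[OF p'(3) AE_I2[OF p'(1)] meas] by (simp add: mult.commute)
qed

lemma mass_one:
  assumes p: "feasible_density p"
  shows "(\<integral>s. p s \<partial>R) = 1"
proof -
  have pr: "prob_space (\<mu> 0)" by (rule mu_prob) (rule le0)
  have "integrable (\<mu> 0) (\<lambda>a. 1 :: real)"
    by (rule finite_measure.integrable_const[OF prob_space.finite_measure[OF pr]])
  from moment(2)[OF p le0 measurable_const this]
  have "(\<integral>s. 1 * p s \<partial>R) = (\<integral>a. 1 \<partial>\<mu> 0)" by simp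
  also have "\<dots> = 1" using prob_space.prob_space[OF pr] by simp
  finally show ?thesis by simp
qed

text \<open>The bounded separable functions, whose moments encode the marginals.\<close>

definition V :: "((nat \<Rightarrow> 'a) \<Rightarrow> real) set" where
  "V = {sep_sum T x | x. \<forall>t\<le>T. x t \<in> borel_measurable (borel_of (S t)) \<and> (\<exists>B. \<forall>a. \<bar>x t a\<bar> \<le> B)}"

lemma V_single:
  assumes t: "t \<le> T" and x: "x \<in> borel_measurable (borel_of (S t))" "\<And>a. \<bar>x a\<bar> \<le> B"
  shows "(\<lambda>s. x (s t)) \<in> V"
  unfolding V_def
proof (intro CollectI exI conjI allI impI)
  let ?x = "\<lambda>i a. if i = t then x a else 0"
  show "(\<lambda>s. x (s t)) = sep_sum T ?x"
    using t by (simp add: sep_sum_def fun_eq_iff sum.delta)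
  show "?x i \<in> borel_measurable (borel_of (S i))" if "i \<le> T" for i
    using x(1) by (cases "i = t") auto
  show "\<bar>?x i a\<bar> \<le> \<bar>B\<bar>" for i a
    using x(2)[of a] by auto
qed

lemma V_moment:
  assumes g: "g \<in> V" and p: "feasible_density p" "feasible_density q"
  shows "(\<integral>s. g s * p s \<partial>R) = (\<integral>s. g s * q s \<partial>R)"
proof -
  obtain x where x: "g = sep_sum T x" "\<And>t. t \<le> T \<Longrightarrow> x t \<in> borel_measurable (borel_of (S t))"
    "\<And>t. t \<le> T \<Longrightarrow> \<exists>B. \<forall>a. \<bar>x t a\<bar> \<le> B"
    using g by (auto simp: V_def)
  have int: "integrable (\<mu> t) (x t)" if t: "t \<le> T" for t
  proof -
    interpret prob_space "\<mu> t" by (rule mu_prob[OF t])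
    obtain B where "\<And>a. \<bar>x t a\<bar> \<le> B" using x(3)[OF t] by auto
    then show ?thesis
      using x(2)[OF t] by (intro integrable_const_bound[where B = B]) (auto simp: measurable_mu[OF t])
  qed
  have "(\<integral>s. g s * r s \<partial>R) = (\<Sum>t\<le>T. \<integral>a. x t a \<partial>\<mu> t)" if r: "feasible_density r" for r
  proof -
    have "(\<integral>s. g s * r s \<partial>R) = (\<integral>s. (\<Sum>t\<le>T. x t (s t) * r s) \<partial>R)"
      by (simp add: x(1) sep_sum_def sum_distrib_right)
    also have "\<dots> = (\<Sum>t\<le>T. \<integral>s. x t (s t) * r s \<partial>R)"
      using moment(1)[OF r _ x(2) int] by (intro Bochner_Integration.integral_sum) auto
    also have "\<dots> = (\<Sum>t\<le>T. \<integral>a. x t a \<partial>\<mu> t)"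
      using moment(2)[OF r _ x(2) int] by (intro sum.cong) auto
    finally show ?thesis .
  qed
  then show ?thesis using p by simp
qed

lemma emeasure_marginal_density:
  assumes t: "t \<le> T" and p: "\<And>s. 0 \<le> p s" "integrable R p" and A: "A \<in> sets (borel_of (S t))"
  shows "emeasure (marginal S (density R p) t) A = ennreal (\<integral>s. indicator A (s t) * p s \<partial>R)"
proof -
  have [measurable]: "p \<in> borel_measurable R" using p by auto
  note proj[measurable] = proj_meas[OF t]
  have ind: "(\<lambda>s. indicator A (s t) :: real) \<in> borel_measurable R"
    using A by (intro measurable_compose[OF proj] borel_measurable_indicator)
  have "emeasure (marginal S (density R p) t) A = emeasure (density R p) ((\<lambda>s. s t) -` A \<inter> space R)"
    unfolding marginal_def using A by (subst emeasure_distr) auto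
  also have "\<dots> = (\<integral>\<^sup>+s. ennreal (p s) * indicator ((\<lambda>s. s t) -` A \<inter> space R) s \<partial>R)"
    using A by (intro emeasure_density) auto
  also have "\<dots> = (\<integral>\<^sup>+s. ennreal (indicator A (s t) * p s) \<partial>R)"
    by (intro nn_integral_cong) (auto split: split_indicator)
  also have "\<dots> = ennreal (\<integral>s. indicator A (s t) * p s \<partial>R)"
  proof (rule nn_integral_eq_integral)
    show "integrable R (\<lambda>s. indicator A (s t) * p s)"
      by (rule Bochner_Integration.integrable_bound[OF p(2)])
        (use ind in \<open>auto split: split_indicator\<close>)
  qed (use p in auto)
  finally show ?thesis .
qed

lemma marginal_eqI:
  assumes q: "\<And>s. 0 \<le> q s" "integrable R q" and p: "feasible_density p"
    and mom: "\<And>g. g \<in> V \<Longrightarrow> (\<integral>s. g s * q s \<partial>R) = (\<integral>s. g s * p s \<partial>R)" and t: "t \<le> T"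
  shows "marginal S (density R q) t = \<mu> t"
proof -
  note p' = feasible_densityD[OF p]
  have "marginal S (density R q) t = marginal S (density R p) t"
  proof (rule measure_eqI)
    fix A assume "A \<in> sets (marginal S (density R q) t)"
    then have A: "A \<in> sets (borel_of (S t))" by (simp add: marginal_def)
    have "(\<lambda>s. indicator A (s t)) \<in> V"
      using A by (intro V_single[OF t, where B = 1]) (auto split: split_indicator)
    then show "emeasure (marginal S (density R q) t) A = emeasure (marginal S (density R p) t) A"
      using emeasure_marginal_density[OF t q A] emeasure_marginal_density[OF t p'(1,2) A] mom by simp
  qed (simp add: marginal_def)
  then show ?thesis using p'(5)[OF t] by simp
qed

lemma moment_constraints_V:
  assumes p: "feasible_density p" and pos: "AE s in R. 0 < p s"
  shows "moment_constraints R V p"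
proof
  note p' = feasible_densityD[OF p]
  show "(\<lambda>s. 1) \<in> V" by (rule V_single[of 0 "\<lambda>a. 1" 1]) auto
  show "integrable R p" "integrable R (\<lambda>s. p s * ln (p s))" "\<And>s. 0 \<le> p s" by (fact p')+
  show "AE s in R. 0 < p s" by fact
  show "(\<integral>s. p s \<partial>R) = 1" by (rule mass_one[OF p])
  fix g assume "g \<in> V"
  then obtain x where x: "g = sep_sum T x" "\<And>t. t \<le> T \<Longrightarrow> x t \<in> borel_measurable (borel_of (S t))"
    "\<And>t. t \<le> T \<Longrightarrow> \<exists>B. \<forall>a. \<bar>x t a\<bar> \<le> B"
    by (auto simp: V_def)
  show "g \<in> borel_measurable R" using sep_sum_meas_R[of x] x by simp
  obtain B where B: "\<And>t a. t \<le> T \<Longrightarrow> \<bar>x t a\<bar> \<le> B t" using x(3) by metis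
  show "\<exists>B. \<forall>s. \<bar>g s\<bar> \<le> B"
  proof (intro exI allI)
    fix s
    have "\<bar>g s\<bar> \<le> (\<Sum>t\<le>T. \<bar>x t (s t)\<bar>)" unfolding x(1) sep_sum_def by (rule sum_abs)
    also have "\<dots> \<le> (\<Sum>t\<le>T. B t)" using B by (intro sum_mono) auto
    finally show "\<bar>g s\<bar> \<le> (\<Sum>t\<le>T. B t)" .
  qed
  fix h c assume "h \<in> V"
  then obtain y where y: "h = sep_sum T y" "\<And>t. t \<le> T \<Longrightarrow> y t \<in> borel_measurable (borel_of (S t))"
    "\<And>t. t \<le> T \<Longrightarrow> \<exists>B. \<forall>a. \<bar>y t a\<bar> \<le> B"
    by (auto simp: V_def)
  obtain B' where B': "\<And>t a. t \<le> T \<Longrightarrow> \<bar>y t a\<bar> \<le> B' t" using y(3) by metis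
  show "(\<lambda>s. g s + c * h s) \<in> V"
    unfolding V_def
  proof (intro CollectI exI conjI allI impI)
    let ?z = "\<lambda>t a. x t a + c * y t a"
    show "(\<lambda>s. g s + c * h s) = sep_sum T ?z"
      by (simp add: x(1) y(1) sep_sum_def fun_eq_iff sum.distrib sum_distrib_left)
    fix t assume t: "t \<le> T"
    show "?z t \<in> borel_measurable (borel_of (S t))" using x(2)[OF t] y(2)[OF t] by measurable
    show "\<bar>?z t a\<bar> \<le> B t + \<bar>c\<bar> * B' t" for a
      using B[OF t, of a] mult_left_mono[OF B'[OF t, of a], of "\<bar>c\<bar>"]
      by (intro order_trans[OF abs_triangle_ineq]) (simp add: abs_mult)
  qed
qed

text \<open>
  If some feasible density is positive, then there is a unique entropy minimizer, and it is the exponential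
  of a separable function. The limit of the minimizing sequence has this form almost everywhere; it is
  replaced by the version \<open>f'\<close> that has it everywhere.
\<close>

lemma ex_separable_optimum:
  assumes p: "feasible_density p" and pos: "AE s in R. 0 < p s"
    and ac: "absolutely_continuous R (PiM {..T} \<mu>)"
  obtains x f where "x \<in> L0_family T S" "feasible_density f" "\<And>s. f s = exp (- sep_sum T x s)"
    "\<And>q. feasible_density q \<Longrightarrow> H f \<le> H q"
    "\<And>q. feasible_density q \<Longrightarrow> H q \<le> H f \<Longrightarrow> AE s in R. q s = f s"
proof -
  interpret mc: moment_constraints R V p by (rule moment_constraints_V[OF p pos])
  obtain g f W where "minimizing_sequence R V p g f W"
    by (rule mc.ex_minimizing_sequence)
  then interpret ms: minimizing_sequence R V p g f W .
  have "\<exists>x. g n = sep_sum T x \<and> (\<forall>t\<le>T. x t \<in> borel_measurable (borel_of (S t)))" for n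
    using ms.g_V[of n] by (auto simp: V_def)
  then obtain gs where gs: "\<And>n. g n = sep_sum T (gs n)"
      "\<And>n t. t \<le> T \<Longrightarrow> gs n t \<in> borel_measurable (borel_of (S t))"
    by metis
  note p' = feasible_densityD[OF p]
  have "\<exists>x. (\<forall>t\<le>T. x t \<in> borel_measurable (\<mu> t)) \<and> (AE s in R. ln (f s) = sep_sum T x s)"
  proof (rule separable_limit[OF mu_prob _ _ ac])
    show "gs n t \<in> borel_measurable (\<mu> t)" if "t \<le> T" for n t
      using gs(2) that by (simp add: measurable_mu)
    show "AE s in R. (\<lambda>n. sep_sum T (gs n) s) \<longlonglongrightarrow> ln (f s)"
      using ms.lim_ln by (simp add: gs(1))
    show "AE s in R. P (s t)" if t: "t \<le> T" and P: "AE a in \<mu> t. P a" for t P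
    proof -
      have "AE s in density R p. P (s t)"
      proof (rule AE_distrD[where f = "\<lambda>s. s t" and P = P])
        show "(\<lambda>s. s t) \<in> density R p \<rightarrow>\<^sub>M borel_of (S t)" using proj_meas[OF t] by simp
        show "AE a in distr (density R p) (borel_of (S t)) (\<lambda>s. s t). P a"
          using P unfolding p'(5)[OF t, unfolded marginal_def] .
      qed
      then have "AE s in R. 0 < p s \<longrightarrow> P (s t)"
        using p' by (simp add: AE_density)
      then show ?thesis using pos by eventually_elim simp
    qed
  qed (auto simp: space_PiM_mu)
  then obtain y where y: "\<And>t. t \<le> T \<Longrightarrow> y t \<in> borel_measurable (\<mu> t)" "AE s in R. ln (f s) = sep_sum T y s"
    by auto
  define x where "x t a = - y t a" for t a
  define f' where "f' s = exp (- sep_sum T x s)" for s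
  have x: "x \<in> L0_family T S"
    unfolding L0_family_def x_def using y(1) by (auto simp: measurable_mu)
  have sep_x: "sep_sum T x s = - sep_sum T y s" for s
    unfolding x_def by (rule sep_sum_uminus)
  have ff': "AE s in R. f s = f' s"
    using y(2) ms.f_pos
  proof eventually_elim
    case (elim s)
    have "f s = exp (ln (f s))" using elim(2) by simp
    also have "\<dots> = f' s" unfolding elim(1) f'_def sep_x by simp
    finally show ?case .
  qed
  have f'_meas[measurable]: "f' \<in> borel_measurable R"
    unfolding f'_def using sep_sum_meas_R[of x] x by (auto simp: L0_family_def)
  have f'_int: "integrable R f'"
    by (rule integrable_cong_AE_imp[OF ms.f_int]) (use ff' in auto)
  have ent_AE: "AE s in R. f' s * ln (f' s) = f s * ln (f s)" using ff' by eventually_elim simp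
  have f'_ent: "integrable R (\<lambda>s. f' s * ln (f' s))"
    by (rule integrable_cong_AE_imp[OF ms.f_entropy(1)]) (use ff' in auto)
  have H_f': "H f' = (\<integral>s. f s * ln (f s) \<partial>R)"
    unfolding H_def by (rule integral_cong_AE) (use ent_AE in auto)
  have mom: "(\<integral>s. a s * f' s \<partial>R) = (\<integral>s. a s * p s \<partial>R)" if a: "a \<in> V" for a
  proof -
    have "(\<integral>s. a s * f' s \<partial>R) = (\<integral>s. a s * f s \<partial>R)"
      by (rule integral_cong_AE) (use ff' mc.V_meas[OF a] in auto)
    then show ?thesis using ms.moment_eq[OF a] by simp
  qed
  have f'_nn: "0 \<le> f' s" for s by (simp add: f'_def)
  have feas: "feasible_density f'"
    unfolding feasible_density_def
    using f'_int f'_ent f'_nn marginal_eqI[OF f'_nn f'_int p mom] by blast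
  have gap: "H f' \<le> H q \<and> (H q \<le> H f' \<longrightarrow> (AE s in R. q s = f' s))" if q: "feasible_density q" for q
  proof -
    note q' = feasible_densityD[OF q]
    let ?d = "\<lambda>s. q s * ln (q s) - q s + f s - ln (f s) * q s"
    have int: "integrable R ?d" and le: "(\<integral>s. ?d s \<partial>R) + H f' \<le> H q"
      using ms.entropy_gap[OF q'(2,1,4) V_moment[OF _ q p]]
      by (auto simp: H_f' H_def[of q])
    have nn: "AE s in R. 0 \<le> ?d s"
      using ms.f_pos
    proof eventually_elim
      case (elim s)
      then show ?case using entropy_fenchel(1)[OF q'(1)[of s], of "ln (f s)"] by simp
    qed
    then have "0 \<le> (\<integral>s. ?d s \<partial>R)" by (rule integral_nonneg_AE)
    moreover have "AE s in R. q s = f' s" if "H q \<le> H f'"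
    proof -
      have "(\<integral>s. ?d s \<partial>R) = 0" using le that \<open>0 \<le> (\<integral>s. ?d s \<partial>R)\<close> by linarith
      then have "AE s in R. ?d s = 0"
        using integral_nonneg_eq_0_iff_AE[OF int nn] by simp
      then show ?thesis
        using ms.f_pos ff'
      proof eventually_elim
        case (elim s)
        then have "q s = exp (ln (f s))" by (intro entropy_fenchel(2)[OF q'(1)]) simp
        then show ?case using elim by simp
      qed
    qed
    ultimately show ?thesis using le by auto
  qed
  show thesis
    by (rule that[OF x feas]) (use gap f'_def in auto)
qed

end

section \<open>Optimality of separable exponential densities\<close>

lemma abs_le_exp_minus: "\<bar>u\<bar> \<le> exp u - (u :: real)"
proof (cases "0 \<le> u")
  case True
  have "0 \<le> (u - 1)\<^sup>2" by simp
  then show ?thesis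
    using True exp_lower_Taylor_quadratic[OF True] by (simp add: power2_eq_square algebra_simps)
next
  case False
  then show ?thesis by simp
qed

context schrodinger
begin

lemma integral_sep_sum:
  assumes q: "feasible_density q"
    and y: "\<And>t. t \<le> T \<Longrightarrow> y t \<in> borel_measurable (borel_of (S t))" "\<And>t. t \<le> T \<Longrightarrow> integrable (\<mu> t) (y t)"
  shows "integrable (density R q) (sep_sum T y)"
    and "(\<integral>s. sep_sum T y s \<partial>density R q) = (\<Sum>t\<le>T. \<integral>a. y t a \<partial>\<mu> t)"
proof -
  note q' = feasible_densityD[OF q]
  have int: "integrable (density R q) (\<lambda>s. y t (s t))" if "t \<le> T" for t
    using marginal_integral(1)[OF that _ q'(5)[OF that] y(1)[OF that]] y(2)[OF that] by simp
  then show "integrable (density R q) (sep_sum T y)"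
    unfolding sep_sum_def by (intro Bochner_Integration.integrable_sum) auto
  have "(\<integral>s. sep_sum T y s \<partial>density R q) = (\<Sum>t\<le>T. \<integral>s. y t (s t) \<partial>density R q)"
    unfolding sep_sum_def using int by (intro Bochner_Integration.integral_sum) auto
  also have "\<dots> = (\<Sum>t\<le>T. \<integral>a. y t a \<partial>\<mu> t)"
    using marginal_integral(2)[OF _ _ q'(5) y(1)] by (intro sum.cong) auto
  finally show "(\<integral>s. sep_sum T y s \<partial>density R q) = (\<Sum>t\<le>T. \<integral>a. y t a \<partial>\<mu> t)" .
qed

text \<open>
  Fubini's theorem under the product measure (with density \<open>r\<close>) handles the positive parts of the summands;
  the negative parts are then integrable under \<open>f\<close>, because their sum is the sum of the positive parts
  minus the integrable function \<open>sep_sum T y\<close>.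
\<close>

lemma integrable_components_of_product:
  assumes f: "feasible_density f" and r: "feasible_density r" "PiM {..T} \<mu> = density R r"
    and y: "\<And>t. t \<le> T \<Longrightarrow> y t \<in> borel_measurable (borel_of (S t))"
    and int_f: "integrable (density R f) (sep_sum T y)"
    and int_r: "integrable (density R r) (\<lambda>s. max 0 (sep_sum T y s))" and t: "t \<le> T"
  shows "integrable (\<mu> t) (y t)"
proof -
  note f' = feasible_densityD[OF f]
  have y_mu: "y i \<in> borel_measurable (\<mu> i)" if "i \<le> T" for i
    using y that by (simp add: measurable_mu)
  have "(\<integral>\<^sup>+s. ennreal (sep_sum T y s) \<partial>PiM {..T} \<mu>) = (\<integral>\<^sup>+s. ennreal (max 0 (sep_sum T y s)) \<partial>density R r)"
    unfolding r(2) by (intro nn_integral_cong) (auto simp: max_def ennreal_neg)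
  also have "\<dots> < \<infinity>" using int_r by (simp add: real_integrable_def less_top)
  finally have fin: "(\<integral>\<^sup>+s. ennreal (sep_sum T y s) \<partial>PiM {..T} \<mu>) < \<infinity>" .
  have pos: "integrable (\<mu> i) (\<lambda>a. max 0 (y i a))" if i: "i \<le> T" for i
  proof (rule integrableI_nonneg)
    have "(\<integral>\<^sup>+a. ennreal (max 0 (y i a)) \<partial>\<mu> i) = (\<integral>\<^sup>+a. ennreal (y i a) \<partial>\<mu> i)"
      by (intro nn_integral_cong) (auto simp: max_def ennreal_neg)
    then show "(\<integral>\<^sup>+a. ennreal (max 0 (y i a)) \<partial>\<mu> i) < \<infinity>"
      using nn_integral_component_finite[OF mu_prob y_mu fin i] by simp
  qed (use y_mu[OF i] in auto)
  have marg: "integrable (density R f) (\<lambda>s. z (s i)) \<longleftrightarrow> integrable (\<mu> i) z"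
    if "i \<le> T" "z \<in> borel_measurable (borel_of (S i))" for i and z :: "'a \<Rightarrow> real"
    by (rule marginal_integral(1)[OF that(1) _ f'(5)[OF that(1)] that(2)]) simp
  have "integrable (density R f) (\<lambda>s. (\<Sum>i\<le>T. max 0 (y i (s i))) - sep_sum T y s)"
    using int_f pos y marg[of _ "\<lambda>a. max 0 (y _ a)"]
    by (intro Bochner_Integration.integrable_diff Bochner_Integration.integrable_sum) auto
  also have "(\<lambda>s. (\<Sum>i\<le>T. max 0 (y i (s i))) - sep_sum T y s) = (\<lambda>s. \<Sum>i\<le>T. max 0 (- y i (s i)))"
    unfolding sep_sum_def sum_subtractf[symmetric] by (intro ext sum.cong) auto
  finally have neg_sum: "integrable (density R f) (\<lambda>s. \<Sum>i\<le>T. max 0 (- y i (s i)))" .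
  have "integrable (density R f) (\<lambda>s. max 0 (- y t (s t)))"
  proof (rule Bochner_Integration.integrable_bound[OF neg_sum])
    show "(\<lambda>s. max 0 (- y t (s t))) \<in> borel_measurable (density R f)"
      using measurable_compose[OF proj_meas[OF t] y[OF t]] by simp
    have "max 0 (- y t (s t)) \<le> (\<Sum>i\<le>T. max 0 (- y i (s i)))" for s
      using t by (intro member_le_sum[of t _ "\<lambda>i. max 0 (- y i (s i))"]) auto
    then show "AE s in density R f. norm (max 0 (- y t (s t))) \<le> norm (\<Sum>i\<le>T. max 0 (- y i (s i)))"
      by (intro AE_I2) (auto intro: order_trans[OF _ abs_ge_self])
  qed
  then have "integrable (\<mu> t) (\<lambda>a. max 0 (- y t a))"
    using marg[OF t, of "\<lambda>a. max 0 (- y t a)"] y[OF t] by simp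
  then have "integrable (\<mu> t) (\<lambda>a. max 0 (y t a) - max 0 (- y t a))"
    by (intro Bochner_Integration.integrable_diff pos t)
  also have "(\<lambda>a. max 0 (y t a) - max 0 (- y t a)) = y t" by auto
  finally show ?thesis .
qed

lemma finite_measure_density:
  assumes q: "feasible_density q"
  shows "finite_measure (density R q)"
  using density_imp_feasible[OF q] by (simp add: SP_feasible_def weighted_measures_def)

lemma integral_sep_sum_eq:
  assumes f: "feasible_density f" and q: "feasible_density q"
    and y: "\<And>t. t \<le> T \<Longrightarrow> y t \<in> borel_measurable (borel_of (S t))"
    and int_f: "integrable (density R f) (sep_sum T y)"
    and int_pos: "\<And>r. feasible_density r \<Longrightarrow> integrable (density R r) (\<lambda>s. max 0 (sep_sum T y s))"
    and cases: "T = 1 \<or> SP_feasible T S \<psi> R \<mu> (PiM {..T} \<mu>)"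
  shows "integrable (density R q) (sep_sum T y)"
    and "(\<integral>s. sep_sum T y s \<partial>density R q) = (\<integral>s. sep_sum T y s \<partial>density R f)"
proof -
  have "integrable (density R q) (sep_sum T y) \<and>
    (\<integral>s. sep_sum T y s \<partial>density R q) = (\<integral>s. sep_sum T y s \<partial>density R f)"
    using cases
  proof
    assume "SP_feasible T S \<psi> R \<mu> (PiM {..T} \<mu>)"
    then obtain r where r: "feasible_density r" "PiM {..T} \<mu> = density R r"
      using feasible_imp_density by blast
    have "integrable (\<mu> t) (y t)" if "t \<le> T" for t
      by (rule integrable_components_of_product[OF f r y int_f int_pos[OF r(1)] that])
    then show ?thesis
      using integral_sep_sum[OF f y] integral_sep_sum[OF q y] by simp
  next
    assume T: "T = 1"
    let ?a = "\<lambda>s. y 0 (s 0)" and ?b = "\<lambda>s. y 1 (s 1)"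
    have sum: "sep_sum T y = (\<lambda>s. ?a s + ?b s)"
      by (simp add: sep_sum_def T fun_eq_iff)
    have meas: "(\<lambda>s. y t (s t)) \<in> borel_measurable (density R r)" if "t \<le> T" for t r
      using measurable_compose[OF proj_meas[OF that] y[OF that]] by simp
    have clip: "(\<integral>s. clip n (y t (s t)) \<partial>density R f) = (\<integral>s. clip n (y t (s t)) \<partial>density R q)" if t: "t \<le> T" for t n
    proof -
      have c: "(\<lambda>a. clip n (y t a)) \<in> borel_measurable (borel_of (S t))" using y[OF t] by simp
      show ?thesis
        using marginal_integral(2)[OF t _ feasible_densityD(5)[OF f t] c]
          marginal_integral(2)[OF t _ feasible_densityD(5)[OF q t] c] by simp
    qed
    have le: "0 \<le> T" "1 \<le> T" using T by auto
    note eq = integral_add_eq_of_clip[where U = ?a and V = ?b, OF finite_measure_density[OF f]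
        finite_measure_density[OF q] meas[OF le(1)] meas[OF le(2)] meas[OF le(1)] meas[OF le(2)]
        clip[OF le(1)] clip[OF le(2)] int_f[unfolded sum] int_pos[OF q, unfolded sum]]
    show ?thesis unfolding sum using eq by blast
  qed
  then show "integrable (density R q) (sep_sum T y)"
    and "(\<integral>s. sep_sum T y s \<partial>density R q) = (\<integral>s. sep_sum T y s \<partial>density R f)"
    by blast+
qed

text \<open>
  The summands of \<open>- sep_sum T x\<close> are only measurable, so the equality of its integrals under \<open>f\<close> and \<open>q\<close>
  rests on \<open>integral_sep_sum_eq\<close>; Fenchel with \<open>b\<close> the positive part of
  \<open>- sep_sum T x\<close> supplies the integrability of that part.
\<close>

lemma separable_imp_optimal:
  assumes f: "feasible_density f" and x: "x \<in> L0_family T S"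
    and fx: "AE s in R. f s = exp (- sep_sum T x s)"
    and cases: "T = 1 \<or> SP_feasible T S \<psi> R \<mu> (PiM {..T} \<mu>)"
    and q: "feasible_density q"
  shows "H f \<le> H q"
proof -
  note f' = feasible_densityD[OF f] and q' = feasible_densityD[OF q]
  define y where "y t a = - x t a" for t a
  let ?g = "sep_sum T y"
  have y: "y t \<in> borel_measurable (borel_of (S t))" if "t \<le> T" for t
    using x that unfolding y_def by (simp add: L0_family_def)
  have g_meas[measurable]: "?g \<in> borel_measurable R" by (rule sep_sum_meas_R[OF y])
  have [measurable]: "f \<in> borel_measurable R" "q \<in> borel_measurable R" by (fact f' q')+
  have fg: "AE s in R. f s = exp (?g s)"
    using fx by (simp add: y_def[abs_def] sep_sum_uminus)
  have exp_int: "integrable R (\<lambda>s. exp (?g s))"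
    by (rule integrable_cong_AE_imp[OF f'(2)]) (use fg in auto)
  have exp_one: "(\<integral>s. exp (?g s) \<partial>R) = 1"
  proof -
    have "(\<integral>s. exp (?g s) \<partial>R) = (\<integral>s. f s \<partial>R)"
      by (rule integral_cong_AE) (use fg in auto)
    then show ?thesis using mass_one[OF f] by simp
  qed
  have ent: "AE s in R. f s * ln (f s) = f s * ?g s" using fg by eventually_elim simp
  have fg_int: "integrable R (\<lambda>s. f s * ?g s)"
    by (rule integrable_cong_AE_imp[OF f'(4)]) (use ent in auto)
  have int_f: "integrable (density R f) ?g"
    using fg_int integrable_real_density[OF f'(3) AE_I2[OF f'(1)] g_meas] by simp
  have H_f: "(\<integral>s. ?g s \<partial>density R f) = H f"
  proof -
    have "(\<integral>s. ?g s \<partial>density R f) = (\<integral>s. f s * ?g s \<partial>R)"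
      by (rule integral_real_density[OF f'(3) AE_I2[OF f'(1)] g_meas])
    also have "\<dots> = H f" unfolding H_def by (rule integral_cong_AE) (use ent in auto)
    finally show ?thesis .
  qed
  have int_pos: "integrable (density R r) (\<lambda>s. max 0 (?g s))" if r: "feasible_density r" for r
  proof -
    note r' = feasible_densityD[OF r]
    have [measurable]: "r \<in> borel_measurable R" by (fact r')
    have bound: "r s * max 0 (?g s) \<le> r s * ln (r s) - r s + 1 + exp (?g s)" for s
    proof -
      have "exp (max 0 (?g s)) \<le> 1 + exp (?g s)" by (cases "0 \<le> ?g s") auto
      then show ?thesis
        using entropy_fenchel(1)[OF r'(1)[of s], of "max 0 (?g s)"] by (simp add: mult.commute)
    qed
    have "integrable R (\<lambda>s. r s * max 0 (?g s))"
    proof (rule Bochner_Integration.integrable_bound)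
      show "integrable R (\<lambda>s. r s * ln (r s) - r s + 1 + exp (?g s))"
        using r' exp_int by simp
      show "AE s in R. norm (r s * max 0 (?g s)) \<le> norm (r s * ln (r s) - r s + 1 + exp (?g s))"
        using bound r'(1) by (intro AE_I2) (auto simp: abs_mult intro: order_trans[OF _ abs_ge_self])
    qed measurable
    then show ?thesis
      using integrable_real_density[OF r'(3) AE_I2[OF r'(1)], of "\<lambda>s. max 0 (?g s)"] by simp
  qed
  note eq = integral_sep_sum_eq[OF f q y int_f int_pos cases]
  have int_q: "integrable R (\<lambda>s. ?g s * q s)"
    using eq(1) integrable_real_density[OF q'(3) AE_I2[OF q'(1)] g_meas] by (simp add: mult.commute)
  have H_q: "(\<integral>s. ?g s * q s \<partial>R) = H f"
    using eq(2) H_f integral_real_density[OF q'(3) AE_I2[OF q'(1)] g_meas] by (simp add: mult.commute)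
  have "0 \<le> (\<integral>s. q s * ln (q s) - q s + exp (?g s) - ?g s * q s \<partial>R)"
    by (intro integral_nonneg_AE AE_I2 entropy_fenchel(1) q'(1))
  also have "\<dots> = H q - H f"
    using q' exp_int int_q H_q exp_one mass_one[OF q] by (simp add: H_def)
  finally show ?thesis by simp
qed

lemma optimal_density_iff:
  assumes p: "feasible_density p"
  shows "SP_optimal T S \<psi> R \<mu> (density R p) \<longleftrightarrow> (\<forall>q. feasible_density q \<longrightarrow> H p \<le> H q)"
proof -
  have "SP_optimal T S \<psi> R \<mu> (density R p) \<longleftrightarrow>
    (\<forall>\<nu>. SP_feasible T S \<psi> R \<mu> \<nu> \<longrightarrow> SP_objective R (density R p) \<le> SP_objective R \<nu>)"
    using density_imp_feasible[OF p] by (auto simp: SP_optimal_def is_arg_min_linorder)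
  also have "\<dots> \<longleftrightarrow> (\<forall>q. feasible_density q \<longrightarrow> SP_objective R (density R p) \<le> SP_objective R (density R q))"
    using density_imp_feasible feasible_imp_density by blast
  also have "\<dots> \<longleftrightarrow> (\<forall>q. feasible_density q \<longrightarrow> H p \<le> H q)"
    by (simp add: objective_density p)
  finally show ?thesis .
qed

lemma optimal_iff_separable:
  assumes feas: "SP_feasible T S \<psi> R \<mu> \<nu>\<^sub>0" and equiv: "equivalent_measures R \<nu>\<^sub>0"
    and ac: "absolutely_continuous R (PiM {..T} \<mu>)"
    and cases: "T = 1 \<or> SP_feasible T S \<psi> R \<mu> (PiM {..T} \<mu>)"
  shows "\<exists>\<nu>. SP_optimal T S \<psi> R \<mu> \<nu>"
    and "SP_feasible T S \<psi> R \<mu> \<nu> \<Longrightarrow> SP_optimal T S \<psi> R \<mu> \<nu> \<longleftrightarrow>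
      (\<exists>x\<in>L0_family T S. AE s in R. RN_deriv R \<nu> s = ennreal (exp (- sep_sum T x s)))"
proof -
  obtain p where p: "feasible_density p" "\<nu>\<^sub>0 = density R p"
    using feasible_imp_density[OF feas] by blast
  have "AE s in density R p. 0 < p s"
    using feasible_densityD(3)[OF p(1)] by (simp add: AE_density)
  then have pos: "AE s in R. 0 < p s"
    using equiv p(2) by (intro absolutely_continuous_AE'[of "density R p" R]) (auto simp: equivalent_measures_def)
  obtain x f where x: "x \<in> L0_family T S" and f: "feasible_density f" and fx: "\<And>s. f s = exp (- sep_sum T x s)"
    and opt: "\<And>q. feasible_density q \<Longrightarrow> H f \<le> H q"
    and uniq: "\<And>q. feasible_density q \<Longrightarrow> H q \<le> H f \<Longrightarrow> AE s in R. q s = f s"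
    using ex_separable_optimum[OF p(1) pos ac] by blast
  show "\<exists>\<nu>. SP_optimal T S \<psi> R \<mu> \<nu>"
    using optimal_density_iff[OF f] opt by blast
  assume "SP_feasible T S \<psi> R \<mu> \<nu>"
  then obtain q where q: "feasible_density q" and \<nu>: "\<nu> = density R q"
    and rn: "\<And>s. q s = enn2real (RN_deriv R \<nu> s)"
    using feasible_imp_density by metis
  have RN: "AE s in R. ennreal (q s) = RN_deriv R \<nu> s"
    using feasible_densityD(3)[OF q] by (intro R.RN_deriv_unique) (auto simp: \<nu>)
  show "SP_optimal T S \<psi> R \<mu> \<nu> \<longleftrightarrow>
      (\<exists>x\<in>L0_family T S. AE s in R. RN_deriv R \<nu> s = ennreal (exp (- sep_sum T x s)))"
  proof
    assume "SP_optimal T S \<psi> R \<mu> \<nu>"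
    then have "H q \<le> H f" using f by (simp add: \<nu> optimal_density_iff[OF q])
    from uniq[OF q this] RN have "AE s in R. RN_deriv R \<nu> s = ennreal (exp (- sep_sum T x s))"
      by eventually_elim (metis fx)
    then show "\<exists>x\<in>L0_family T S. AE s in R. RN_deriv R \<nu> s = ennreal (exp (- sep_sum T x s))"
      using x by blast
  next
    assume "\<exists>x\<in>L0_family T S. AE s in R. RN_deriv R \<nu> s = ennreal (exp (- sep_sum T x s))"
    then obtain y where y: "y \<in> L0_family T S" "AE s in R. RN_deriv R \<nu> s = ennreal (exp (- sep_sum T y s))"
      by blast
    have "AE s in R. q s = exp (- sep_sum T y s)"
      using y(2) by eventually_elim (simp add: rn)
    then show "SP_optimal T S \<psi> R \<mu> \<nu>"
      using separable_imp_optimal[OF q y(1) _ cases] by (simp add: \<nu> optimal_density_iff[OF q])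
  qed
qed

lemma dual_feasible_integrable:
  assumes feas: "SP_feasible T S \<psi> R \<mu> (PiM {..T} \<mu>)"
    and dual: "dual_feasible T S R \<mu> x" and t: "t \<le> T"
  shows "integrable (\<mu> t) (x t)"
proof -
  let ?P = "PiM {..T} \<mu>"
  let ?X = "sep_sum T x"
  obtain \<phi> where \<phi>: "feasible_density \<phi>" and P: "?P = density R \<phi>"
    and rn: "\<And>s. \<phi> s = enn2real (RN_deriv R ?P s)"
    using feasible_imp_density[OF feas] by blast
  note \<phi>' = feasible_densityD[OF \<phi>]
  have [measurable]: "\<phi> \<in> borel_measurable R" by (fact \<phi>')
  have \<phi>_meas[measurable]: "\<phi> \<in> borel_measurable ?P" by (simp add: P)
  have x: "x i \<in> borel_measurable (\<mu> i)" if "i \<le> T" for i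
    using dual that by (simp add: dual_feasible_def L0_family_def measurable_mu)
  have X_meas[measurable]: "?X \<in> borel_measurable ?P" by (rule sep_sum_measurable_PiM[OF x])
  let ?h = "\<lambda>s. ?X s + (exp (- ?X s) - 1) / \<phi> s"
  have h_fin: "(\<integral>\<^sup>+s. ennreal (?h s) \<partial>?P) < \<infinity>"
    using dual by (auto simp: dual_feasible_def dual_objective_def ext_integral_def rn split: if_splits)
  have ln_int: "integrable ?P (\<lambda>s. ln (\<phi> s))"
    unfolding P using \<phi>'(4) by (subst integrable_real_density) (auto simp: \<phi>'(1))
  have inv_fin: "(\<integral>\<^sup>+s. ennreal (1 / \<phi> s) \<partial>?P) < \<infinity>"
  proof -
    have "(\<integral>\<^sup>+s. ennreal (1 / \<phi> s) \<partial>?P) = (\<integral>\<^sup>+s. ennreal (\<phi> s * (1 / \<phi> s)) \<partial>R)"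
      unfolding P
      by (subst nn_integral_density) (auto intro!: nn_integral_cong simp: \<phi>'(1) ennreal_mult'[symmetric])
    also have "\<dots> \<le> (\<integral>\<^sup>+s. 1 \<partial>R)" by (intro nn_integral_mono) auto
    also have "\<dots> < \<infinity>" by (simp add: R.emeasure_space_1)
    finally show ?thesis .
  qed
  have pos: "AE s in ?P. 0 < \<phi> s"
    unfolding P by (simp add: AE_density)
  let ?u = "\<lambda>s. - ?X s - ln (\<phi> s)"
  have u_int: "integrable ?P ?u"
  proof (rule integrableI_bounded)
    have "(\<integral>\<^sup>+s. ennreal (norm (?u s)) \<partial>?P)
        \<le> (\<integral>\<^sup>+s. ennreal (?h s) + ennreal (1 / \<phi> s) + ennreal (norm (ln (\<phi> s))) \<partial>?P)"
    proof (rule nn_integral_mono_AE, use pos in eventually_elim)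
      case (elim s)
      have "\<bar>?u s\<bar> \<le> exp (?u s) - ?u s" by (rule abs_le_exp_minus)
      also have "\<dots> = ?h s + 1 / \<phi> s + ln (\<phi> s)"
        using elim by (simp add: exp_diff diff_divide_distrib)
      also have "\<dots> \<le> max 0 (?h s) + 1 / \<phi> s + \<bar>ln (\<phi> s)\<bar>" by linarith
      finally have "ennreal \<bar>?u s\<bar> \<le> ennreal (max 0 (?h s) + 1 / \<phi> s + \<bar>ln (\<phi> s)\<bar>)"
        by (rule ennreal_leI)
      also have "\<dots> = ennreal (max 0 (?h s)) + ennreal (1 / \<phi> s) + ennreal \<bar>ln (\<phi> s)\<bar>"
        using elim by (simp add: ennreal_plus)
      also have "ennreal (max 0 (?h s)) = ennreal (?h s)" by (simp add: max_def ennreal_neg)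
      finally show ?case by simp
    qed
    also have "\<dots> = (\<integral>\<^sup>+s. ennreal (?h s) \<partial>?P) + (\<integral>\<^sup>+s. ennreal (1 / \<phi> s) \<partial>?P)
        + (\<integral>\<^sup>+s. ennreal (norm (ln (\<phi> s))) \<partial>?P)"
      by (simp add: nn_integral_add)
    also have "\<dots> < \<infinity>"
      using h_fin inv_fin ln_int by (simp add: integrable_iff_bounded)
    finally show "(\<integral>\<^sup>+s. ennreal (norm (?u s)) \<partial>?P) < \<infinity>" .
  qed measurable
  have "integrable ?P (\<lambda>s. - (?u s) - ln (\<phi> s))"
    by (rule Bochner_Integration.integrable_diff[OF Bochner_Integration.integrable_minus[OF u_int] ln_int])
  then have "integrable ?P ?X" by simp
  from integrable_component[OF mu_prob x this t] show ?thesis .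
qed

end

theorem theorem23:
  fixes T :: nat
    and S :: "nat \<Rightarrow> 'a topology"
    and \<psi> :: "nat \<Rightarrow> 'a \<Rightarrow> real"
    and R :: "(nat \<Rightarrow> 'a) measure"
    and \<mu> :: "nat \<Rightarrow> 'a measure"
  assumes polish: "\<And>t. t \<le> T \<Longrightarrow> Polish_space (S t)"
    and psi_cont: "\<And>t. t \<le> T \<Longrightarrow> continuous_map (S t) euclideanreal (\<psi> t)"
    and psi_ge_1: "\<And>t a. t \<le> T \<Longrightarrow> a \<in> topspace (S t) \<Longrightarrow> 1 \<le> \<psi> t a"
    and R: "R \<in> weighted_measures (prod_space T S) (sep_sum T \<psi>)" "prob_space R"
    and mu: "\<And>t. t \<le> T \<Longrightarrow> \<mu> t \<in> weighted_measures (S t) (\<psi> t)"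
            "\<And>t. t \<le> T \<Longrightarrow> prob_space (\<mu> t)"
  shows
    "(T = 1 \<and> absolutely_continuous R (PiM {..T} \<mu>) \<and>
        (\<exists>\<nu>. SP_feasible T S \<psi> R \<mu> \<nu> \<and> equivalent_measures R \<nu>)
      \<longrightarrow>
        (\<exists>\<nu>. SP_optimal T S \<psi> R \<mu> \<nu>) \<and>
        (\<forall>\<nu>. SP_feasible T S \<psi> R \<mu> \<nu> \<longrightarrow>
           (SP_optimal T S \<psi> R \<mu> \<nu> \<longleftrightarrow>
            (\<exists>x\<in>L0_family T S. AE s in R. RN_deriv R \<nu> s = ennreal (exp (- sep_sum T x s))))))
     \<and>
     (SP_feasible T S \<psi> R \<mu> (PiM {..T} \<mu>) \<and> equivalent_measures R (PiM {..T} \<mu>)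
      \<longrightarrow>
        (\<exists>\<nu>. SP_optimal T S \<psi> R \<mu> \<nu>) \<and>
        (\<forall>\<nu>. SP_feasible T S \<psi> R \<mu> \<nu> \<longrightarrow>
           (SP_optimal T S \<psi> R \<mu> \<nu> \<longleftrightarrow>
            (\<exists>x\<in>L0_family T S. AE s in R. RN_deriv R \<nu> s = ennreal (exp (- sep_sum T x s))))) \<and>
        (\<forall>x. dual_feasible T S R \<mu> x \<longrightarrow> (\<forall>t\<le>T. integrable (\<mu> t) (x t))))"
proof -
  interpret schrodinger T S \<psi> R \<mu>
    by (rule schrodinger.intro) (fact R mu)+
  show ?thesis
  proof (intro conjI impI allI; elim conjE exE)
    fix \<nu>\<^sub>0
    assume "T = 1" "absolutely_continuous R (PiM {..T} \<mu>)"
      "SP_feasible T S \<psi> R \<mu> \<nu>\<^sub>0" "equivalent_measures R \<nu>\<^sub>0"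
    note * = optimal_iff_separable[OF this(3,4,2) disjI1[OF this(1)]]
    show "\<exists>\<nu>. SP_optimal T S \<psi> R \<mu> \<nu>" by (rule *(1))
    show "SP_optimal T S \<psi> R \<mu> \<nu> \<longleftrightarrow>
      (\<exists>x\<in>L0_family T S. AE s in R. RN_deriv R \<nu> s = ennreal (exp (- sep_sum T x s)))"
      if "SP_feasible T S \<psi> R \<mu> \<nu>" for \<nu>
      by (rule *(2)[OF that])
  next
    assume P: "SP_feasible T S \<psi> R \<mu> (PiM {..T} \<mu>)" "equivalent_measures R (PiM {..T} \<mu>)"
    then have "absolutely_continuous R (PiM {..T} \<mu>)" by (simp add: equivalent_measures_def)
    note * = optimal_iff_separable[OF P this disjI2[OF P(1)]]
    show "\<exists>\<nu>. SP_optimal T S \<psi> R \<mu> \<nu>" by (rule *(1))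
    show "SP_optimal T S \<psi> R \<mu> \<nu> \<longleftrightarrow>
      (\<exists>x\<in>L0_family T S. AE s in R. RN_deriv R \<nu> s = ennreal (exp (- sep_sum T x s)))"
      if "SP_feasible T S \<psi> R \<mu> \<nu>" for \<nu>
      by (rule *(2)[OF that])
    show "integrable (\<mu> t) (x t)" if "dual_feasible T S R \<mu> x" "t \<le> T" for x t
      by (rule dual_feasible_integrable[OF P(1) that])
  qed
qed

end
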